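(* Let $R$ be a commutative ring, $\mathfrak a\subseteq I$ finitely generated ideals of $R$, and $f_0\in\mathfrak a$ an $R$-regular element. Then, as ideals of $R/(f_0)$, $$\operatorname{Kitt}(\mathfrak a,I)/(f_0)=\operatorname{Kitt}(\mathfrak a/(f_0),\,I/(f_0)).$$
   Context: For a commutative ring $A$, ideals $I=(f_1,\dots,f_r)\supseteq\mathfrak a=(a_1,\dots,a_s)$ and a matrix $(c_{ij})$ with $a_j=\sum_i c_{ij}f_i$: let $K_\bullet(\mathbf f;A)$ be the Koszul DG algebra (exterior algebra on $e_1,\dots,e_r$, $\partial e_i=f_i$), $\zeta_j=\sum_i c_{ij}e_i$, $\Gamma_\bullet$ the subalgebra generated by the $\zeta_j$, $Z_\bullet$ the subalgebra of Koszul cycles. $\operatorname{Kitt}(\mathfrak a,I)$ is the degree-$r$ component of the subalgebra generated by $\Gamma_\bullet$ and $Z_\bullet$ (the span of $\gamma\wedge z$, $\gamma\in\Gamma_j$, $z\in Z_{r-j}$), identified with an ideal of $A$ via $K_r=Ae_1\wedge\cdots\wedge e_r\cong A$; it does not depend on the choices of generators and matrix. *)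

theory Defs
  imports "HOL-Algebra.QuotRing"
begin

text \<open>Koszul DG algebra K(f_1,...,f_r; A) over a ring R (HOL-Algebra record).
  Indices of the generators e_i are 0..r-1. An element of the exterior algebra is
  represented by its coefficient function on subsets S of {..<r}
  (coefficient of e_S = e_{i1} wedge ... wedge e_{ik}, i1 < ... < ik).\<close>

definition ext_sgn :: "('a, 'b) ring_scheme \<Rightarrow> nat \<Rightarrow> 'a" where
  "ext_sgn R n = (if even n then \<one>\<^bsub>R\<^esub> else \<ominus>\<^bsub>R\<^esub> \<one>\<^bsub>R\<^esub>)"

text \<open>number of inversions: e_S wedge e_T = (-1)^inv S T e_(S union T) for disjoint S, T\<close>
definition ext_inv :: "nat set \<Rightarrow> nat set \<Rightarrow> nat" where
  "ext_inv S T = card {(s, t). s \<in> S \<and> t \<in> T \<and> t < s}"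

definition ext_wedge :: "('a, 'b) ring_scheme \<Rightarrow> nat \<Rightarrow> (nat set \<Rightarrow> 'a) \<Rightarrow> (nat set \<Rightarrow> 'a) \<Rightarrow> nat set \<Rightarrow> 'a" where
  "ext_wedge R r x y = (\<lambda>U. if U \<subseteq> {..<r}
      then finsum R (\<lambda>S. ext_sgn R (ext_inv S (U - S)) \<otimes>\<^bsub>R\<^esub> x S \<otimes>\<^bsub>R\<^esub> y (U - S)) (Pow U)
      else \<zero>\<^bsub>R\<^esub>)"

definition ext_one :: "('a, 'b) ring_scheme \<Rightarrow> nat set \<Rightarrow> 'a" where
  "ext_one R = (\<lambda>S. if S = {} then \<one>\<^bsub>R\<^esub> else \<zero>\<^bsub>R\<^esub>)"

definition ext_homog :: "('a, 'b) ring_scheme \<Rightarrow> nat \<Rightarrow> nat \<Rightarrow> (nat set \<Rightarrow> 'a) \<Rightarrow> bool" where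
  "ext_homog R r k x \<longleftrightarrow> (\<forall>S. x S \<in> carrier R) \<and>
      (\<forall>S. (\<not> S \<subseteq> {..<r} \<or> card S \<noteq> k) \<longrightarrow> x S = \<zero>\<^bsub>R\<^esub>)"

text \<open>Koszul differential with d(e_i) = f_i:
  d(e_{i1} wedge ... wedge e_{ik}) = sum_m (-1)^(m-1) f_{im} e_{i1}..(omit im)..e_{ik}\<close>
definition koszul_diff :: "('a, 'b) ring_scheme \<Rightarrow> 'a list \<Rightarrow> (nat set \<Rightarrow> 'a) \<Rightarrow> nat set \<Rightarrow> 'a" where
  "koszul_diff R fs x = (\<lambda>T. finsum R
      (\<lambda>i. ext_sgn R (card {j \<in> T. j < i}) \<otimes>\<^bsub>R\<^esub> (fs ! i) \<otimes>\<^bsub>R\<^esub> x (insert i T))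
      ({..<length fs} - T))"

definition koszul_cycles :: "('a, 'b) ring_scheme \<Rightarrow> 'a list \<Rightarrow> nat \<Rightarrow> (nat set \<Rightarrow> 'a) set" where
  "koszul_cycles R fs k = {z. ext_homog R (length fs) k z \<and> (\<forall>T. koszul_diff R fs z T = \<zero>\<^bsub>R\<^esub>)}"

text \<open>zeta_j = sum_i c_ij e_i\<close>
definition kzeta :: "('a, 'b) ring_scheme \<Rightarrow> nat \<Rightarrow> (nat \<Rightarrow> nat \<Rightarrow> 'a) \<Rightarrow> nat \<Rightarrow> nat set \<Rightarrow> 'a" where
  "kzeta R r c j = (\<lambda>S. if card S = 1 \<and> S \<subseteq> {..<r} then c (the_elem S) j else \<zero>\<^bsub>R\<^esub>)"

definition zeta_monomial :: "('a, 'b) ring_scheme \<Rightarrow> nat \<Rightarrow> (nat \<Rightarrow> nat \<Rightarrow> 'a) \<Rightarrow> nat list \<Rightarrow> nat set \<Rightarrow> 'a" where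
  "zeta_monomial R r c js = foldr (\<lambda>j acc. ext_wedge R r (kzeta R r c j) acc) js (ext_one R)"

text \<open>Gamma_k: degree-k component of the subalgebra generated by zeta_0, ..., zeta_(s-1),
  i.e. the R-span of the products of k of the zetas\<close>
inductive_set kgamma :: "('a, 'b) ring_scheme \<Rightarrow> nat \<Rightarrow> (nat \<Rightarrow> nat \<Rightarrow> 'a) \<Rightarrow> nat \<Rightarrow> nat \<Rightarrow> (nat set \<Rightarrow> 'a) set"
  for R r c s k where
  zero: "(\<lambda>S. \<zero>\<^bsub>R\<^esub>) \<in> kgamma R r c s k"
| mono: "a \<in> carrier R \<Longrightarrow> length js = k \<Longrightarrow> set js \<subseteq> {..<s} \<Longrightarrow>
         (\<lambda>S. a \<otimes>\<^bsub>R\<^esub> zeta_monomial R r c js S) \<in> kgamma R r c s k"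
| add: "x \<in> kgamma R r c s k \<Longrightarrow> y \<in> kgamma R r c s k \<Longrightarrow>
         (\<lambda>S. x S \<oplus>\<^bsub>R\<^esub> y S) \<in> kgamma R r c s k"

text \<open>Kitt computed from generators fs = [f_1..f_r] of I and a matrix c, with
  a_j = sum_i c_ij f_i for j < s: the ideal spanned by the e_1..e_r-coefficients
  of gamma wedge z, gamma in Gamma_j, z in Z_(r-j).\<close>
definition kitt_gens :: "('a, 'b) ring_scheme \<Rightarrow> 'a list \<Rightarrow> (nat \<Rightarrow> nat \<Rightarrow> 'a) \<Rightarrow> nat \<Rightarrow> 'a set" where
  "kitt_gens R fs c s = genideal R
     {ext_wedge R (length fs) \<gamma> z {..<length fs} | \<gamma> z j.
        j \<le> length fs \<and> \<gamma> \<in> kgamma R (length fs) c s j \<and> z \<in> koszul_cycles R fs (length fs - j)}"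

text \<open>Kitt(a, I) for finitely generated ideals a \<subseteq> I: computed from some choice of
  generators and matrix (the result is independent of the choice).\<close>
definition Kitt :: "('a, 'b) ring_scheme \<Rightarrow> 'a set \<Rightarrow> 'a set \<Rightarrow> 'a set" where
  "Kitt R \<aa> I = (SOME K. \<exists>fs c s.
      set fs \<subseteq> carrier R \<and> genideal R (set fs) = I \<and>
      (\<forall>i j. c i j \<in> carrier R) \<and>
      genideal R {finsum R (\<lambda>i. c i j \<otimes>\<^bsub>R\<^esub> fs ! i) {..<length fs} | j. j < s} = \<aa> \<and>
      K = kitt_gens R fs c s)"

definition fin_gen_ideal :: "('a, 'b) ring_scheme \<Rightarrow> 'a set \<Rightarrow> bool" where
  "fin_gen_ideal R J \<longleftrightarrow> ideal J R \<and> (\<exists>S. finite S \<and> S \<subseteq> carrier R \<and> J = genideal R S)"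

definition regular_elem :: "('a, 'b) ring_scheme \<Rightarrow> 'a \<Rightarrow> bool" where
  "regular_elem R x \<longleftrightarrow> x \<in> carrier R \<and> (\<forall>y \<in> carrier R. x \<otimes>\<^bsub>R\<^esub> y = \<zero>\<^bsub>R\<^esub> \<longrightarrow> y = \<zero>\<^bsub>R\<^esub>)"

end

(* The matrix c plays no role beyond the ideal a: the subalgebra generated by the zeta_j and the
   Koszul cycles equals the one generated by the cycles together with all degree-one elements v with
   boundary in a, because two degree-one elements with the same boundary differ by a cycle. The
   generating family f plays no role beyond the ideal I: adjoining a redundant generator splits off
   a free cycle eta of degree one, and any two families are subfamilies of their disjoint union.
   So both sides may be computed from convenient data: the family f_1, ..., f_r, f_0 over R and its
   image without f_0 over R/(f_0). A cycle over R has the form x + e_0 y with dx = - f_0 y; since f_0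
   is regular, every cycle x modulo f_0 extends in this way, and since f_0 lies in a, multiplication
   by e_0 is available and identifies the top coefficients. *)

theory Submission
  imports Defs
begin

text \<open>\<open>Kitt\<close> is a Hilbert choice over generators and matrices, so nothing can be
  said about it until every admissible choice is shown to give the same ideal and one admissible
  choice is exhibited. The intermediary is \<open>kitt_top\<close>, which takes an index set, a
  coefficient function and the ideal \<open>\<aa>\<close>, and mentions neither a matrix nor
  degrees. Degrees would get in the way at the quotient: passing from r + 1 generators to r shifts
  the top degree, and the parts x and y of x + e_0 y have different degrees. Reading one coefficient
  of inhomogeneous elements avoids this bookkeeping. The induction over the generated algebra must
  follow both parts, because multiplication by a degree-one v = v_0 e_0 + v' sends (x, y) to (v' x,
  v_0 x - v' y). Regularity enters when a cycle is lifted: lifting coefficients gives dx = f_0 w,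
  hence f_0 dw = ddx = 0, and cancelling f_0 makes w a cycle.\<close>

section \<open>Sign exponents: how many factors a generator passes to reach its sorted place\<close>

definition below :: "nat \<Rightarrow> nat set \<Rightarrow> nat" where
  "below i S = card {j \<in> S. j < i}"

lemma finite_below [simp]: "finite {j \<in> S. j < (i::nat)}"
  by (rule finite_subset[of _ "{..<i}"]) auto

lemma below_insert [simp]:
  "j \<notin> S \<Longrightarrow> below i (insert j S) = (if j < i then Suc (below i S) else below i S)"
proof -
  assume j: "j \<notin> S"
  have "{k \<in> insert j S. k < i} = (if j < i then insert j {k \<in> S. k < i} else {k \<in> S. k < i})"
    by auto
  then show ?thesis using j by (simp add: below_def)
qed

lemma below_remove:
  "j \<in> S \<Longrightarrow> below i S = (if j < i then Suc (below i (S - {j})) else below i (S - {j}))"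
  using below_insert[of j "S - {j}" i] by (simp add: insert_absorb)

lemma below_Un:
  assumes "S \<inter> T = {}"
  shows "below i (S \<union> T) = below i S + below i T"
proof -
  have "{j \<in> S \<union> T. j < i} = {j \<in> S. j < i} \<union> {j \<in> T. j < i}" by auto
  moreover have "{j \<in> S. j < i} \<inter> {j \<in> T. j < i} = {}" using assms by blast
  ultimately show ?thesis by (simp add: below_def card_Un_disjoint)
qed

lemma ext_inv_empty [simp]: "ext_inv {} T = 0"
  by (simp add: ext_inv_def)

text \<open>The new inversions are the pairs with first entry i, one for each element of T below i.
  Signs of products can thus be built up one generator at a time.\<close>

lemma ext_inv_insert:
  assumes "finite S" "finite T" "i \<notin> S"
  shows "ext_inv (insert i S) T = ext_inv S T + below i T"
proof -
  have "{(s, t). s \<in> insert i S \<and> t \<in> T \<and> t < s} =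
      {(s, t). s \<in> S \<and> t \<in> T \<and> t < s} \<union> Pair i ` {t \<in> T. t < i}" (is "_ = ?A \<union> ?B")
    by auto
  moreover have "finite ?A"
    using assms by (intro finite_subset[of ?A "S \<times> T"]) auto
  moreover have "?A \<inter> ?B = {}" using assms by auto
  moreover have "card ?B = below i T"
    unfolding below_def by (intro card_image) (simp add: inj_on_def)
  ultimately show ?thesis
    unfolding ext_inv_def by (simp add: card_Un_disjoint)
qed

context cring
begin

subsection \<open>Linear combinations of operators on coefficient functions\<close>

text \<open>The index type is left open so that one notion covers both coordinate vectors (indexed
  by \<open>nat\<close>) and exterior-algebra elements (indexed by \<open>nat set\<close>).\<close>

definition fns :: "('i \<Rightarrow> 'a) set" where
  "fns = {x. \<forall>i. x i \<in> carrier R}"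

lemma fns_iff [simp]: "x \<in> fns \<longleftrightarrow> (\<forall>i. x i \<in> carrier R)"
  by (simp add: fns_def)

definition fadd :: "('i \<Rightarrow> 'a) \<Rightarrow> ('i \<Rightarrow> 'a) \<Rightarrow> 'i \<Rightarrow> 'a" where
  "fadd x y = (\<lambda>i. x i \<oplus> y i)"

definition fsmult :: "'a \<Rightarrow> ('i \<Rightarrow> 'a) \<Rightarrow> 'i \<Rightarrow> 'a" where
  "fsmult a x = (\<lambda>i. a \<otimes> x i)"

definition fneg :: "('i \<Rightarrow> 'a) \<Rightarrow> 'i \<Rightarrow> 'a" where
  "fneg x = (\<lambda>i. \<ominus> x i)"

definition fzero :: "'i \<Rightarrow> 'a" where
  "fzero = (\<lambda>i. \<zero>)"

lemma fun_ops_apply [simp]: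
  "fadd x y i = x i \<oplus> y i" "fsmult a x i = a \<otimes> x i" "fneg x i = \<ominus> x i" "fzero i = \<zero>"
  by (simp_all add: fadd_def fsmult_def fneg_def fzero_def)

definition linop :: "(('i \<Rightarrow> 'a) \<Rightarrow> 'j \<Rightarrow> 'a) \<Rightarrow> bool" where
  "linop T \<longleftrightarrow> (\<forall>x\<in>fns. T x \<in> fns) \<and> (\<forall>x\<in>fns. \<forall>y\<in>fns. T (fadd x y) = fadd (T x) (T y)) \<and>
     (\<forall>a\<in>carrier R. \<forall>x\<in>fns. T (fsmult a x) = fsmult a (T x))"

lemma linopD:
  assumes "linop T" "x \<in> fns"
  shows "T x \<in> fns" "y \<in> fns \<Longrightarrow> T (fadd x y) = fadd (T x) (T y)"
    "a \<in> carrier R \<Longrightarrow> T (fsmult a x) = fsmult a (T x)"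
  using assms unfolding linop_def by blast+

lemma linop_closed: "linop T \<Longrightarrow> x \<in> fns \<Longrightarrow> T x S \<in> carrier R"
  using linopD(1) by auto

lemma fsmult_zero: "x \<in> fns \<Longrightarrow> fsmult \<zero> x = fzero"
  by (rule ext) simp

lemma fsmult_minus_one: "x \<in> fns \<Longrightarrow> fsmult (\<ominus> \<one>) x = fneg x"
  by (rule ext) (simp add: l_minus)

lemma linop_zero: "linop T \<Longrightarrow> T fzero = fzero"
  using linopD(1)[of T fzero] linopD(3)[of T fzero \<zero>] by (simp only: fsmult_zero fns_iff fun_ops_apply zero_closed simp_thms)

lemma linop_neg: "linop T \<Longrightarrow> x \<in> fns \<Longrightarrow> T (fneg x) = fneg (T x)"
  using linopD(1)[of T x] linopD(3)[of T x "\<ominus> \<one>"] by (simp only: fsmult_minus_one a_inv_closed one_closed)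

text \<open>One scheme for two uses: multiplication by a degree-one element, where v holds its
  coordinates, and the Koszul differential, where v holds the generators f.\<close>

definition lincomb :: "(nat \<Rightarrow> ('i \<Rightarrow> 'a) \<Rightarrow> 'i \<Rightarrow> 'a) \<Rightarrow> nat set \<Rightarrow> (nat \<Rightarrow> 'a) \<Rightarrow> ('i \<Rightarrow> 'a) \<Rightarrow> 'i \<Rightarrow> 'a" where
  "lincomb T N v x = (\<lambda>S. \<Oplus>i\<in>N. v i \<otimes> T i x S)"

text \<open>For coordinates v of a degree-one element, this is its boundary in the Koszul complex of
  f.\<close>

definition pairing :: "nat set \<Rightarrow> (nat \<Rightarrow> 'a) \<Rightarrow> (nat \<Rightarrow> 'a) \<Rightarrow> 'a" where
  "pairing N v f = (\<Oplus>i\<in>N. v i \<otimes> f i)"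

lemma pairing_closed [simp]: "v \<in> fns \<Longrightarrow> f \<in> fns \<Longrightarrow> pairing N v f \<in> carrier R"
  unfolding pairing_def by (rule finsum_closed) auto

lemma pairing_empty [simp]: "pairing {} v f = \<zero>"
  by (simp add: pairing_def)

lemma pairing_insert [simp]:
  "finite N \<Longrightarrow> i \<notin> N \<Longrightarrow> v \<in> fns \<Longrightarrow> f \<in> fns \<Longrightarrow>
   pairing (insert i N) v f = v i \<otimes> f i \<oplus> pairing N v f"
  unfolding pairing_def by (rule finsum_insert) auto

lemma pairing_fadd:
  assumes "v \<in> fns" "w \<in> fns" "f \<in> fns"
  shows "pairing N (fadd v w) f = pairing N v f \<oplus> pairing N w f"
proof -
  have "pairing N (fadd v w) f = (\<Oplus>i\<in>N. v i \<otimes> f i \<oplus> w i \<otimes> f i)"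
    unfolding pairing_def using assms by (intro finsum_cong') (auto simp: l_distr Pi_iff)
  then show ?thesis
    unfolding pairing_def using assms by (simp add: finsum_addf Pi_iff)
qed

lemma pairing_fsmult:
  assumes "a \<in> carrier R" "v \<in> fns" "f \<in> fns"
  shows "pairing N (fsmult a v) f = a \<otimes> pairing N v f"
proof (cases "finite N")
  case True
  then have "a \<otimes> pairing N v f = (\<Oplus>i\<in>N. a \<otimes> (v i \<otimes> f i))"
    unfolding pairing_def using assms by (intro finsum_rdistr) auto
  also have "\<dots> = pairing N (fsmult a v) f"
    unfolding pairing_def using assms by (intro finsum_cong') (auto simp: m_assoc Pi_iff)
  finally show ?thesis ..
next
  case False
  then show ?thesis using assms by (simp add: pairing_def finsum_infinite)
qed

lemma pairing_fneg:
  assumes "v \<in> fns" "f \<in> fns"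
  shows "pairing N (fneg v) f = \<ominus> pairing N v f"
  using pairing_fsmult[of "\<ominus> \<one>" v f N] assms
  by (simp add: fsmult_minus_one l_minus)

lemma pairing_comm: "v \<in> fns \<Longrightarrow> f \<in> fns \<Longrightarrow> pairing N v f = pairing N f v"
  unfolding pairing_def by (intro finsum_cong') (auto simp: m_comm Pi_iff)

lemma lincomb_eq_pairing: "lincomb T N v x S = pairing N v (\<lambda>i. T i x S)"
  by (simp add: lincomb_def pairing_def)

lemma lincomb_closed [simp]:
  "(\<And>i. linop (T i)) \<Longrightarrow> v \<in> fns \<Longrightarrow> x \<in> fns \<Longrightarrow> lincomb T N v x S \<in> carrier R"
  using linopD(1)[of "T _" x] by (simp add: lincomb_eq_pairing)

lemma lincomb_empty: "lincomb T {} v x = fzero"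
  by (rule ext) (simp add: lincomb_eq_pairing)

lemma lincomb_insert:
  assumes "finite N" "i \<notin> N" "\<And>i. linop (T i)" "v \<in> fns" "x \<in> fns"
  shows "lincomb T (insert i N) v x = fadd (fsmult (v i) (T i x)) (lincomb T N v x)"
  using assms linopD(1)[OF assms(3,5)] by (intro ext) (simp add: lincomb_eq_pairing Pi_iff)

lemma lincomb_fadd_left:
  assumes "\<And>i. linop (T i)" "v \<in> fns" "w \<in> fns" "x \<in> fns"
  shows "lincomb T N (fadd v w) x = fadd (lincomb T N v x) (lincomb T N w x)"
  using assms linopD(1)[OF assms(1,4)] by (intro ext) (simp add: lincomb_eq_pairing Pi_iff pairing_fadd)

lemma lincomb_fsmult_left:
  assumes "\<And>i. linop (T i)" "v \<in> fns" "a \<in> carrier R" "x \<in> fns"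
  shows "lincomb T N (fsmult a v) x = fsmult a (lincomb T N v x)"
  using assms linopD(1)[OF assms(1,4)] by (intro ext) (simp add: lincomb_eq_pairing Pi_iff pairing_fsmult)

lemma linop_lincomb:
  fixes T :: "nat \<Rightarrow> ('i \<Rightarrow> 'a) \<Rightarrow> 'i \<Rightarrow> 'a"
  assumes "\<And>i. linop (T i)" "v \<in> fns"
  shows "linop (lincomb T N v)"
  unfolding linop_def
proof (intro conjI ballI)
  fix x :: "'i \<Rightarrow> 'a"
  assume x: "x \<in> fns"
  show "lincomb T N v x \<in> fns" using assms x by simp
  have Tx: "\<And>S. (\<lambda>i. T i x S) \<in> fns" using linopD(1)[OF assms(1) x] by auto
  show "lincomb T N v (fsmult a x) = fsmult a (lincomb T N v x)" if a: "a \<in> carrier R" for a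
  proof
    fix S
    have "(\<lambda>i. T i (fsmult a x) S) = fsmult a (\<lambda>i. T i x S)"
      by (simp only: linopD(3)[OF assms(1) x a] fun_eq_iff fun_ops_apply simp_thms)
    then have "lincomb T N v (fsmult a x) S = pairing N v (fsmult a (\<lambda>i. T i x S))"
      by (simp only: lincomb_eq_pairing)
    also have "\<dots> = fsmult a (lincomb T N v x) S"
      using assms(2) a Tx[of S] by (simp add: lincomb_eq_pairing pairing_comm[of v] pairing_fsmult)
    finally show "lincomb T N v (fsmult a x) S = fsmult a (lincomb T N v x) S" .
  qed
  show "lincomb T N v (fadd x y) = fadd (lincomb T N v x) (lincomb T N v y)" if y: "y \<in> fns" for y
  proof
    fix S
    have Ty: "\<And>S. (\<lambda>i. T i y S) \<in> fns" using linopD(1)[OF assms(1) y] by auto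
    have "(\<lambda>i. T i (fadd x y) S) = fadd (\<lambda>i. T i x S) (\<lambda>i. T i y S)"
      by (simp only: linopD(2)[OF assms(1) x y] fun_eq_iff fun_ops_apply simp_thms)
    then have "lincomb T N v (fadd x y) S = pairing N v (fadd (\<lambda>i. T i x S) (\<lambda>i. T i y S))"
      by (simp only: lincomb_eq_pairing)
    also have "\<dots> = fadd (lincomb T N v x) (lincomb T N v y) S"
      using assms(2) Tx[of S] Ty[of S] by (simp add: lincomb_eq_pairing pairing_comm[of v] pairing_fadd)
    finally show "lincomb T N v (fadd x y) S = fadd (lincomb T N v x) (lincomb T N v y) S" .
  qed
qed

text \<open>Meant for the operator that wedges with a fixed element on the right, which commutes
  with left multiplication by every generator.\<close>

lemma lincomb_commute:
  assumes T: "linop T" and U: "\<And>i. linop (U i)" and U': "\<And>i. linop (U' i)" and N: "finite N"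
    and com: "\<And>i y. i \<in> N \<Longrightarrow> y \<in> fns \<Longrightarrow> T (U i y) = U' i (T y)"
    and v: "v \<in> fns" and x: "x \<in> fns"
  shows "T (lincomb U N v x) = lincomb U' N v (T x)"
  using N com
proof (induction N)
  case empty
  then show ?case using linop_zero[OF T] by (simp only: lincomb_empty)
next
  case (insert i N)
  note [simp] = linopD[OF T] linop_closed[OF T] linop_closed[OF U] lincomb_closed[OF U]
  have "T (lincomb U (insert i N) v x) = fadd (fsmult (v i) (T (U i x))) (T (lincomb U N v x))"
    using insert.hyps U v x by (simp add: lincomb_insert)
  then show ?case
    using insert U' v x by (simp add: lincomb_insert)
qed

text \<open>Linearity in v reduces everything to single operators. The scalars \<open>k\<close> are
  zero for two operators of the same kind, a Kronecker delta for a contraction against a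
  multiplication, and the coordinates of the multiplier when multiplication is moved past the
  differential.\<close>

lemma lincomb_anticommute:
  assumes T: "linop T" and U: "\<And>i. linop (U i)" and N: "finite N" and k: "k \<in> fns"
    and com: "\<And>i y. i \<in> N \<Longrightarrow> y \<in> fns \<Longrightarrow> T (U i y) = fadd (fsmult (k i) y) (fneg (U i (T y)))"
    and v: "v \<in> fns" and x: "x \<in> fns"
  shows "T (lincomb U N v x) = fadd (fsmult (pairing N v k) x) (fneg (lincomb U N v (T x)))"
  using N com
proof (induction N)
  case empty
  have "fzero = fadd (fsmult \<zero> x) (fneg fzero)"
    using x by (intro ext) simp
  then show ?case using linop_zero[OF T] by (simp only: lincomb_empty pairing_empty)
next
  case (insert i N)
  note [simp] = linopD[OF T] linop_closed[OF T] linop_closed[OF U] lincomb_closed[OF U]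
  have e: "T (U i x) = fadd (fsmult (k i) x) (fneg (U i (T x)))"
    "T (lincomb U N v x) = fadd (fsmult (pairing N v k) x) (fneg (lincomb U N v (T x)))"
    by (rule insert.prems, simp, rule x) (rule insert.IH, rule insert.prems, auto)
  have "T (lincomb U (insert i N) v x) = fadd (fsmult (v i) (T (U i x))) (T (lincomb U N v x))"
    using insert.hyps U v x by (simp add: lincomb_insert)
  also have "\<dots> = fadd (fsmult (v i) (fadd (fsmult (k i) x) (fneg (U i (T x)))))
      (fadd (fsmult (pairing N v k) x) (fneg (lincomb U N v (T x))))"
    by (simp only: e)
  also have "\<dots> = fadd (fsmult (pairing (insert i N) v k) x) (fneg (lincomb U (insert i N) v (T x)))"
  proof
    fix S
    have "v i \<in> carrier R" "k i \<in> carrier R" "x S \<in> carrier R" "U i (T x) S \<in> carrier R"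
      "pairing N v k \<in> carrier R" "lincomb U N v (T x) S \<in> carrier R"
      using v k x U by simp_all
    then have "v i \<otimes> (k i \<otimes> x S \<oplus> \<ominus> U i (T x) S) \<oplus> (pairing N v k \<otimes> x S \<oplus> \<ominus> lincomb U N v (T x) S) =
      (v i \<otimes> k i \<oplus> pairing N v k) \<otimes> x S \<oplus> \<ominus> (v i \<otimes> U i (T x) S \<oplus> lincomb U N v (T x) S)"
      by algebra
    then show "fadd (fsmult (v i) (fadd (fsmult (k i) x) (fneg (U i (T x)))))
      (fadd (fsmult (pairing N v k) x) (fneg (lincomb U N v (T x)))) S =
      fadd (fsmult (pairing (insert i N) v k) x) (fneg (lincomb U (insert i N) v (T x))) S"
      using insert.hyps U v x k by (simp add: lincomb_insert)
  qed
  finally show ?case .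
qed

text \<open>Mixed terms cancel in pairs by anticommutation. Taking i = j in \<open>anti\<close> only
  shows that twice the square vanishes, so the squares need their own hypothesis when 2 is a zero
  divisor.\<close>

lemma lincomb_square_zero:
  assumes U: "\<And>i. linop (U i)" and N: "finite N"
    and anti: "\<And>i j y. y \<in> fns \<Longrightarrow> U i (U j y) = fneg (U j (U i y))"
    and sq: "\<And>i y. y \<in> fns \<Longrightarrow> U i (U i y) = fzero"
    and v: "v \<in> fns" and x: "x \<in> fns"
  shows "lincomb U N v (lincomb U N v x) = fzero"
  using N
proof (induction N)
  case empty
  show ?case by (simp add: lincomb_empty)
next
  case (insert i N)
  note [simp] = linopD[OF U] linop_closed[OF U] linopD[OF linop_lincomb[OF U]] lincomb_closed[OF U]
  have com: "U i (lincomb U N v x) = fneg (lincomb U N v (U i x))"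
  proof -
    have "U i (U j y) = fadd (fsmult (fzero j) y) (fneg (U j (U i y)))" if "y \<in> fns" for j y
      using that by (subst anti) (auto simp: fun_eq_iff)
    then have "U i (lincomb U N v x) = fadd (fsmult (pairing N v fzero) x) (fneg (lincomb U N v (U i x)))"
      using U insert.hyps v x by (intro lincomb_anticommute[where k = fzero and T = "U i"]) simp_all
    moreover have "pairing N v fzero = \<zero>"
      using v by (simp add: pairing_def finsum_zero)
    ultimately show ?thesis using x v U by (simp add: fun_eq_iff)
  qed
  let ?L = "lincomb U N v x"
  have ins: "lincomb U (insert i N) v y = fadd (fsmult (v i) (U i y)) (lincomb U N v y)" if "y \<in> fns" for y
    using insert.hyps U v that by (rule lincomb_insert)
  have "lincomb U (insert i N) v (lincomb U (insert i N) v x) =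
    fadd (fsmult (v i) (U i (fadd (fsmult (v i) (U i x)) ?L))) (lincomb U N v (fadd (fsmult (v i) (U i x)) ?L))"
    unfolding ins[OF x] by (rule ins) (use v x U in simp)
  also have "\<dots> = fadd (fsmult (v i) (fadd (fsmult (v i) (U i (U i x))) (U i ?L)))
     (fadd (fsmult (v i) (lincomb U N v (U i x))) (lincomb U N v ?L))"
    using v x U by simp
  also have "\<dots> = fzero"
    using v x U insert.IH by (simp add: sq com fun_eq_iff r_minus l_neg)
  finally show ?case .
qed

subsection \<open>Exterior multiplication and the Koszul differential\<close>

lemma ext_sgn_closed [simp]: "ext_sgn R n \<in> carrier R"
  by (simp add: ext_sgn_def)

lemma ext_sgn_Suc: "ext_sgn R (Suc n) = \<ominus> ext_sgn R n"
  by (simp add: ext_sgn_def)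

lemma ext_sgn_0 [simp]: "ext_sgn R 0 = \<one>"
  by (simp add: ext_sgn_def)

lemma ext_sgn_square: "ext_sgn R n \<otimes> ext_sgn R n = \<one>"
  by (simp add: ext_sgn_def l_minus r_minus)

lemma ext_sgn_cancel [simp]:
  assumes "a \<in> carrier R"
  shows "ext_sgn R n \<otimes> (ext_sgn R n \<otimes> a) = a"
  using assms by (simp add: m_assoc[symmetric] ext_sgn_square)

lemma ext_sgn_add: "ext_sgn R (m + n) = ext_sgn R m \<otimes> ext_sgn R n"
  by (simp add: ext_sgn_def l_minus r_minus)

text \<open>An exterior-algebra element is a coefficient function, so homogeneous and inhomogeneous elements
  are treated alike. Only multiplication by degree-one elements is ever needed; it and the
  differential are linear combinations of the operators \<open>cre i\<close> (multiply by \<open>e\<^sub>i\<close> on the left) and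
  \<open>ann i\<close> (contract with the dual of \<open>e\<^sub>i\<close>), and every identity below comes from their
  anticommutation relations.\<close>

definition cre :: "nat \<Rightarrow> (nat set \<Rightarrow> 'a) \<Rightarrow> nat set \<Rightarrow> 'a" where
  "cre i x S = (if i \<in> S then ext_sgn R (below i S) \<otimes> x (S - {i}) else \<zero>)"

definition ann :: "nat \<Rightarrow> (nat set \<Rightarrow> 'a) \<Rightarrow> nat set \<Rightarrow> 'a" where
  "ann i x S = (if i \<in> S then \<zero> else ext_sgn R (below i S) \<otimes> x (insert i S))"

lemma linop_cre [simp]: "linop (cre i)" and linop_ann [simp]: "linop (ann i)"
  by (auto simp: linop_def cre_def ann_def fun_eq_iff r_distr m_lcomm)

lemma cre_closed [simp]: "x \<in> fns \<Longrightarrow> cre i x S \<in> carrier R"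
  and ann_closed [simp]: "x \<in> fns \<Longrightarrow> ann i x S \<in> carrier R"
  by (simp_all add: cre_def ann_def)

lemma cre_cre_self: "x \<in> fns \<Longrightarrow> cre i (cre i x) = fzero"
  and ann_ann_self: "x \<in> fns \<Longrightarrow> ann i (ann i x) = fzero"
  by (simp_all add: cre_def ann_def fun_eq_iff)

text \<open>Both sides remove the same two indices. Removing the smaller one first lowers the
  position of the larger by one, while the other order changes no position; this is the single
  sign.\<close>

lemma cre_cre:
  assumes x: "x \<in> fns"
  shows "cre i (cre j x) = fneg (cre j (cre i x))"
proof (cases "i = j")
  case False
  show ?thesis
  proof
    fix S
    have "S - {i} - {j} = S - {j} - {i}" by auto
    moreover have "i \<in> S \<Longrightarrow> j \<in> S \<Longrightarrow> below i S = (if j < i then Suc (below i (S - {j})) else below i (S - {j}))"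
      "i \<in> S \<Longrightarrow> j \<in> S \<Longrightarrow> below j S = (if i < j then Suc (below j (S - {i})) else below j (S - {i}))"
      using below_remove[of j S i] below_remove[of i S j] by blast+
    ultimately show "cre i (cre j x) S = fneg (cre j (cre i x)) S"
      using False x by (auto simp: cre_def ext_sgn_Suc l_minus r_minus m_lcomm)
  qed
qed (use x cre_cre_self in \<open>auto simp: fun_eq_iff\<close>)

lemma ann_ann:
  assumes x: "x \<in> fns"
  shows "ann i (ann j x) = fneg (ann j (ann i x))"
proof (cases "i = j")
  case False
  show ?thesis
  proof
    fix S
    show "ann i (ann j x) S = fneg (ann j (ann i x)) S"
      using False x by (auto simp: ann_def ext_sgn_Suc l_minus r_minus m_lcomm insert_commute)
  qed
qed (use x ann_ann_self in \<open>auto simp: fun_eq_iff\<close>)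

text \<open>For i = j the two composites are complementary projections: the first keeps the
  coefficients at sets avoiding i, the second those at sets containing i. For distinct indices the
  two orders differ by one sign.\<close>

lemma ann_cre:
  assumes x: "x \<in> fns"
  shows "ann i (cre j x) = fadd (fsmult (if i = j then \<one> else \<zero>) x) (fneg (cre j (ann i x)))"
proof
  fix S
  show "ann i (cre j x) S = fadd (fsmult (if i = j then \<one> else \<zero>) x) (fneg (cre j (ann i x))) S"
  proof (cases "i = j")
    case True
    have "j \<in> S \<Longrightarrow> below j S = below j (S - {j})"
      using below_remove[of j S j] by simp
    then show ?thesis
      using True x by (auto simp: cre_def ann_def insert_absorb r_neg)
  next
    case False
    have 1: "insert i S - {j} = insert i (S - {j})" using False by auto
    have "j \<in> S \<Longrightarrow> below i S = (if j < i then Suc (below i (S - {j})) else below i (S - {j}))"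
      using below_remove[of j S i] by blast
    then show ?thesis
      using False x 1 by (auto simp: cre_def ann_def ext_sgn_Suc l_minus r_minus m_lcomm)
  qed
qed

lemma cre_ann:
  assumes x: "x \<in> fns"
  shows "cre j (ann i x) = fadd (fsmult (if i = j then \<one> else \<zero>) x) (fneg (ann i (cre j x)))"
  using x by (subst ann_cre) (auto simp: fun_eq_iff minus_add r_neg2)

definition ext_mult :: "nat set \<Rightarrow> (nat \<Rightarrow> 'a) \<Rightarrow> (nat set \<Rightarrow> 'a) \<Rightarrow> nat set \<Rightarrow> 'a" where
  "ext_mult N v = lincomb cre N v"

definition kdiff :: "nat set \<Rightarrow> (nat \<Rightarrow> 'a) \<Rightarrow> (nat set \<Rightarrow> 'a) \<Rightarrow> nat set \<Rightarrow> 'a" where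
  "kdiff N f = lincomb ann N f"

lemma linop_ext_mult [simp]: "v \<in> fns \<Longrightarrow> linop (ext_mult N v)"
  and linop_kdiff [simp]: "v \<in> fns \<Longrightarrow> linop (kdiff N v)"
  unfolding ext_mult_def kdiff_def by (auto intro!: linop_lincomb)

lemma ext_mult_closed [simp]: "v \<in> fns \<Longrightarrow> x \<in> fns \<Longrightarrow> ext_mult N v x S \<in> carrier R"
  and kdiff_closed [simp]: "f \<in> fns \<Longrightarrow> x \<in> fns \<Longrightarrow> kdiff N f x S \<in> carrier R"
  by (simp_all add: linop_closed)

lemma ext_mult_fadd:
  "v \<in> fns \<Longrightarrow> w \<in> fns \<Longrightarrow> x \<in> fns \<Longrightarrow> ext_mult N (fadd v w) x = fadd (ext_mult N v x) (ext_mult N w x)"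
  unfolding ext_mult_def by (rule lincomb_fadd_left) auto

lemma ext_mult_fsmult:
  "v \<in> fns \<Longrightarrow> a \<in> carrier R \<Longrightarrow> x \<in> fns \<Longrightarrow> ext_mult N (fsmult a v) x = fsmult a (ext_mult N v x)"
  unfolding ext_mult_def by (rule lincomb_fsmult_left) auto

lemma ext_mult_insert:
  "finite N \<Longrightarrow> i \<notin> N \<Longrightarrow> v \<in> fns \<Longrightarrow> x \<in> fns \<Longrightarrow>
   ext_mult (insert i N) v x = fadd (fsmult (v i) (cre i x)) (ext_mult N v x)"
  unfolding ext_mult_def by (rule lincomb_insert) auto

lemma kdiff_insert:
  "finite N \<Longrightarrow> i \<notin> N \<Longrightarrow> f \<in> fns \<Longrightarrow> x \<in> fns \<Longrightarrow>
   kdiff (insert i N) f x = fadd (fsmult (f i) (ann i x)) (kdiff N f x)"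
  unfolding kdiff_def by (rule lincomb_insert) auto

lemma ext_mult_self: "finite N \<Longrightarrow> v \<in> fns \<Longrightarrow> x \<in> fns \<Longrightarrow> ext_mult N v (ext_mult N v x) = fzero"
  unfolding ext_mult_def by (rule lincomb_square_zero) (auto intro: cre_cre cre_cre_self)

lemma kdiff_kdiff: "finite N \<Longrightarrow> f \<in> fns \<Longrightarrow> x \<in> fns \<Longrightarrow> kdiff N f (kdiff N f x) = fzero"
  unfolding kdiff_def by (rule lincomb_square_zero) (auto intro: ann_ann ann_ann_self)

text \<open>Polarization: expand the vanishing square of multiplication by v + w.\<close>

lemma ext_mult_anticommute:
  assumes N: "finite N" and v: "v \<in> fns" and w: "w \<in> fns" and x: "x \<in> fns"
  shows "ext_mult N v (ext_mult N w x) = fneg (ext_mult N w (ext_mult N v x))"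
proof -
  let ?V = "ext_mult N v" and ?W = "ext_mult N w"
  have "fadd v w \<in> fns" using v w by simp
  then have "fzero = ext_mult N (fadd v w) (ext_mult N (fadd v w) x)"
    using ext_mult_self N x by metis
  also have "\<dots> = fadd (?V (fadd (?V x) (?W x))) (?W (fadd (?V x) (?W x)))"
    using v w x by (simp only: ext_mult_fadd fns_iff fun_ops_apply a_closed ext_mult_closed simp_thms)
  also have "\<dots> = fadd (fadd (?V (?V x)) (?V (?W x))) (fadd (?W (?V x)) (?W (?W x)))"
    using v w x by (simp add: linopD(2) fun_eq_iff)
  also have "\<dots> = fadd (?V (?W x)) (?W (?V x))"
    using v w x N by (simp add: ext_mult_self fun_eq_iff)
  finally have "fadd (?V (?W x)) (?W (?V x)) = fzero" by simp
  then show ?thesis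
    using v w x by (simp add: fun_eq_iff minus_equality[symmetric])
qed

lemma ann_ext_mult:
  assumes N: "finite N" and v: "v \<in> fns" and x: "x \<in> fns"
  shows "ann i (ext_mult N v x) =
    fadd (fsmult (if i \<in> N then v i else \<zero>) x) (fneg (ext_mult N v (ann i x)))"
proof -
  have "ann i (lincomb cre N v x) =
      fadd (fsmult (pairing N v (\<lambda>j. if i = j then \<one> else \<zero>)) x) (fneg (lincomb cre N v (ann i x)))"
    using v x N by (intro lincomb_anticommute ann_cre) simp_all
  moreover have "pairing N v (\<lambda>j. if i = j then \<one> else \<zero>) = (if i \<in> N then v i else \<zero>)"
  proof -
    have "pairing N v (\<lambda>j. if i = j then \<one> else \<zero>) = (\<Oplus>j\<in>N. if i = j then v j else \<zero>)"
      unfolding pairing_def using v by (intro finsum_cong') auto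
    also have "\<dots> = (if i \<in> N then v i else \<zero>)"
    proof (cases "i \<in> N")
      case True
      then show ?thesis using N v by (simp add: finsum_singleton[of i N v])
    next
      case False
      then have "(\<Oplus>j\<in>N. if i = j then v j else \<zero>) = (\<Oplus>j\<in>N. \<zero>)"
        by (intro finsum_cong') auto
      then show ?thesis using False by (simp add: finsum_zero)
    qed
    finally show ?thesis .
  qed
  ultimately show ?thesis by (simp add: ext_mult_def)
qed

text \<open>The Leibniz rule for a degree-one left factor. Multiplication by v is moved past each
  contraction, which leaves the scalar \<open>v i\<close> because M lies in N; the result is then
  solved for the other composite.\<close>

lemma kdiff_ext_mult:
  assumes N: "finite N" and M: "finite M" "M \<subseteq> N" and v: "v \<in> fns" and f: "f \<in> fns" and x: "x \<in> fns"
  shows "kdiff M f (ext_mult N v x) = fadd (fsmult (pairing M v f) x) (fneg (ext_mult N v (kdiff M f x)))"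
proof -
  have "ext_mult N v (ann i y) = fadd (fsmult (v i) y) (fneg (ann i (ext_mult N v y)))"
    if "i \<in> M" and y: "y \<in> fns" for i y
    using that M N v by (subst ann_ext_mult) (auto simp: fun_eq_iff minus_add r_neg2)
  then have "ext_mult N v (lincomb ann M f x) =
      fadd (fsmult (pairing M f v) x) (fneg (lincomb ann M f (ext_mult N v x)))"
    using v f x M by (intro lincomb_anticommute[where T = "ext_mult N v"]) simp_all
  then have "ext_mult N v (kdiff M f x) =
      fadd (fsmult (pairing M v f) x) (fneg (kdiff M f (ext_mult N v x)))"
    using v f by (simp add: kdiff_def pairing_comm)
  then show ?thesis
    using v f x by (auto simp: fun_eq_iff minus_add r_neg2)
qed

subsection \<open>The algebra generated by cycles and degree-one elements\<close>

lemma idealI_cring: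
  assumes "I \<subseteq> carrier R" "\<zero> \<in> I" "\<And>a b. a \<in> I \<Longrightarrow> b \<in> I \<Longrightarrow> a \<oplus> b \<in> I"
    and mult: "\<And>a b. a \<in> carrier R \<Longrightarrow> b \<in> I \<Longrightarrow> a \<otimes> b \<in> I"
  shows "ideal I R"
proof (rule idealI)
  have "\<ominus> a \<in> I" if "a \<in> I" for a
    using mult[of "\<ominus> \<one>" a] that assms(1) by (auto simp: l_minus)
  then show "subgroup I (add_monoid R)"
    using assms by (intro add.subgroupI) auto
  show "x \<otimes> a \<in> I" "a \<otimes> x \<in> I" if "a \<in> I" "x \<in> carrier R" for a x
    using that assms(1) mult[of x a] by (auto simp: m_comm)
qed (rule ring_axioms)

lemma pairing_cong:
  "(\<And>i. i \<in> N \<Longrightarrow> v i = w i) \<Longrightarrow> (\<And>i. i \<in> N \<Longrightarrow> f i = g i) \<Longrightarrow> w \<in> fns \<Longrightarrow> g \<in> fns \<Longrightarrow>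
   pairing N v f = pairing N w g"
  unfolding pairing_def by (intro finsum_cong') auto

lemma pairing_zero:
  "(\<And>i. i \<in> N \<Longrightarrow> f i = \<zero>) \<Longrightarrow> v \<in> fns \<Longrightarrow> pairing N v f = \<zero>"
  using pairing_cong[of N v v f fzero] by (simp add: pairing_def finsum_zero)

lemma ext_mult_cong:
  "(\<And>i. i \<in> N \<Longrightarrow> v i = w i) \<Longrightarrow> w \<in> fns \<Longrightarrow> x \<in> fns \<Longrightarrow> ext_mult N v x = ext_mult N w x"
  unfolding ext_mult_def by (intro ext) (simp add: lincomb_eq_pairing, intro pairing_cong, auto)

lemma kdiff_cong:
  "(\<And>i. i \<in> N \<Longrightarrow> f i = g i) \<Longrightarrow> g \<in> fns \<Longrightarrow> x \<in> fns \<Longrightarrow> kdiff N f x = kdiff N g x"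
  unfolding kdiff_def by (intro ext) (simp add: lincomb_eq_pairing, intro pairing_cong, auto)

section \<open>Elements supported on a set of generators\<close>

text \<open>Encoded as a support condition, so that adjoining a generator gives a literal inclusion
  of algebras instead of an embedding.\<close>

definition ext_alg :: "nat set \<Rightarrow> (nat set \<Rightarrow> 'a) set" where
  "ext_alg N = {x \<in> fns. \<forall>S. \<not> S \<subseteq> N \<longrightarrow> x S = \<zero>}"

lemma ext_algD: "x \<in> ext_alg N \<Longrightarrow> x \<in> fns" "x \<in> ext_alg N \<Longrightarrow> x S \<in> carrier R"
  "x \<in> ext_alg N \<Longrightarrow> \<not> S \<subseteq> N \<Longrightarrow> x S = \<zero>"
  by (simp_all add: ext_alg_def)

lemma ext_alg_fadd: "x \<in> ext_alg N \<Longrightarrow> y \<in> ext_alg N \<Longrightarrow> fadd x y \<in> ext_alg N"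
  and ext_alg_fsmult: "a \<in> carrier R \<Longrightarrow> x \<in> ext_alg N \<Longrightarrow> fsmult a x \<in> ext_alg N"
  and ext_alg_fneg: "x \<in> ext_alg N \<Longrightarrow> fneg x \<in> ext_alg N"
  and ext_alg_fzero: "fzero \<in> ext_alg N"
  by (simp_all add: ext_alg_def)

lemma ext_alg_mono: "N \<subseteq> M \<Longrightarrow> ext_alg N \<subseteq> ext_alg M"
  by (auto simp: ext_alg_def)

lemma ext_alg_ext_mult:
  assumes "N \<subseteq> M" "v \<in> fns" "x \<in> ext_alg M"
  shows "ext_mult N v x \<in> ext_alg M"
proof -
  have "ext_mult N v x S = \<zero>" if "\<not> S \<subseteq> M" for S
    unfolding ext_mult_def lincomb_eq_pairing
  proof (rule pairing_zero)
    fix i assume "i \<in> N"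
    then have "\<not> S - {i} \<subseteq> M" using that assms(1) by auto
    then show "cre i x S = \<zero>" using ext_algD(3)[OF assms(3)] by (simp add: cre_def)
  qed fact
  then show ?thesis using assms by (simp add: ext_alg_def)
qed

lemma ext_alg_ann: "x \<in> ext_alg M \<Longrightarrow> ann i x \<in> ext_alg M"
  by (auto simp: ext_alg_def ann_def)

lemma ext_alg_kdiff:
  assumes "f \<in> fns" "x \<in> ext_alg M"
  shows "kdiff N f x \<in> ext_alg M"
proof -
  have "kdiff N f x S = \<zero>" if "\<not> S \<subseteq> M" for S
    unfolding kdiff_def lincomb_eq_pairing
    using ext_algD(3)[OF ext_alg_ann[OF assms(2)] that] assms by (intro pairing_zero) simp_all
  then show ?thesis using assms by (simp add: ext_alg_def)
qed

lemma ann_ext_alg: "m \<notin> N \<Longrightarrow> x \<in> ext_alg N \<Longrightarrow> ann m x = fzero"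
  by (auto simp: ext_alg_def ann_def fun_eq_iff)

text \<open>Up to sign, the coefficient at a set containing m is the coefficient of the contraction
  at that set without m, so contraction detects every occurrence of e_m.\<close>

lemma ext_alg_insertD:
  assumes x: "x \<in> ext_alg (insert m N)" and ann: "ann m x = fzero"
  shows "x \<in> ext_alg N"
proof -
  have "x S = \<zero>" if "m \<in> S" for S
  proof -
    have "ext_sgn R (below m (S - {m})) \<otimes> ann m x (S - {m}) = x S"
      using that ext_algD[OF x] by (simp add: ann_def insert_absorb)
    then show ?thesis using ann by simp
  qed
  then show ?thesis using x by (auto simp: ext_alg_def subset_insert)
qed

definition cycles :: "nat set \<Rightarrow> (nat \<Rightarrow> 'a) \<Rightarrow> (nat set \<Rightarrow> 'a) set" where
  "cycles N f = {z \<in> ext_alg N. kdiff N f z = fzero}"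

lemma cyclesD: "z \<in> cycles N f \<Longrightarrow> z \<in> ext_alg N" "z \<in> cycles N f \<Longrightarrow> z \<in> fns"
  "z \<in> cycles N f \<Longrightarrow> kdiff N f z = fzero"
  by (simp_all add: cycles_def ext_alg_def)

lemma cycles_fsmult: "f \<in> fns \<Longrightarrow> a \<in> carrier R \<Longrightarrow> z \<in> cycles N f \<Longrightarrow> fsmult a z \<in> cycles N f"
  using linopD(3)[OF linop_kdiff[of f N], of z a] by (auto simp: cycles_def ext_alg_fsmult ext_algD fun_eq_iff)

lemma cycles_ext_mult:
  assumes "finite N" "f \<in> fns" "v \<in> fns" "pairing N v f = \<zero>" "z \<in> cycles N f"
  shows "ext_mult N v z \<in> cycles N f"
proof -
  note z = cyclesD[OF assms(5)]
  have "ext_mult N v fzero = fzero" using assms by (intro linop_zero) simp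
  then have "kdiff N f (ext_mult N v z) = fzero"
    unfolding kdiff_ext_mult[OF assms(1,1) order_refl assms(3,2) z(2)] z(3) assms(4)
    using z(2) by (simp add: fun_eq_iff)
  then show ?thesis using ext_alg_ext_mult[OF _ assms(3) z(1)] by (simp add: cycles_def)
qed

text \<open>Cycles form a subalgebra and the exterior algebra is graded-commutative, so the algebra
  generated by the cycles and V is spanned by products v_1 ... v_k z. Closure under sums and left
  multiplication by V therefore suffices.\<close>

inductive_set koszul_alg :: "nat set \<Rightarrow> (nat \<Rightarrow> 'a) \<Rightarrow> (nat \<Rightarrow> 'a) set \<Rightarrow> (nat set \<Rightarrow> 'a) set"
  for N f V where
  cycle: "z \<in> cycles N f \<Longrightarrow> z \<in> koszul_alg N f V"
| add: "x \<in> koszul_alg N f V \<Longrightarrow> y \<in> koszul_alg N f V \<Longrightarrow> fadd x y \<in> koszul_alg N f V"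
| mult: "v \<in> V \<Longrightarrow> x \<in> koszul_alg N f V \<Longrightarrow> ext_mult N v x \<in> koszul_alg N f V"

lemma koszul_alg_subset:
  assumes "V \<subseteq> fns" "x \<in> koszul_alg N f V"
  shows "x \<in> ext_alg N"
  using assms(2)
proof induction
  case (mult v x)
  then show ?case using assms(1) by (intro ext_alg_ext_mult) auto
qed (blast intro: cyclesD ext_alg_fadd)+

lemma koszul_alg_fns:
  assumes "V \<subseteq> fns" "x \<in> koszul_alg N f V"
  shows "x \<in> fns"
  using koszul_alg_subset[OF assms] ext_algD by blast

text \<open>Scalars pass through sums and multiplications down to the cycles, which absorb them; the
  inductive definition has no rule for them.\<close>

lemma koszul_alg_fsmult:
  assumes V: "V \<subseteq> fns" and f: "f \<in> fns" and a: "a \<in> carrier R" and "x \<in> koszul_alg N f V"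
  shows "fsmult a x \<in> koszul_alg N f V"
  using assms(4)
proof induction
  case (cycle z)
  then show ?case using f a by (intro koszul_alg.cycle cycles_fsmult)
next
  case (add x y)
  have "fsmult a (fadd x y) = fadd (fsmult a x) (fsmult a y)"
    using a koszul_alg_fns[OF V] add by (simp add: fun_eq_iff r_distr)
  then show ?case using add koszul_alg.add by metis
next
  case (mult v x)
  have "fsmult a (ext_mult N v x) = ext_mult N v (fsmult a x)"
    using a koszul_alg_fns[OF V mult(2)] mult(1) V by (subst linopD(3)) auto
  then show ?case using mult koszul_alg.mult by metis
qed

lemma koszul_alg_fneg:
  assumes V: "V \<subseteq> fns" and f: "f \<in> fns" and x: "x \<in> koszul_alg N f V"
  shows "fneg x \<in> koszul_alg N f V"
  using koszul_alg_fsmult[OF V f _ x, of "\<ominus> \<one>"] koszul_alg_fns[OF V x] fsmult_minus_one[of x] by simp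

text \<open>Coordinates outside N are only required to lie in the carrier: neither
  \<open>pairing N\<close> nor \<open>ext_mult N\<close> reads them.\<close>

definition lifts :: "nat set \<Rightarrow> (nat \<Rightarrow> 'a) \<Rightarrow> 'a set \<Rightarrow> (nat \<Rightarrow> 'a) set" where
  "lifts N f \<aa> = {v \<in> fns. pairing N v f \<in> \<aa>}"

lemma lifts_subset: "lifts N f \<aa> \<subseteq> fns"
  by (auto simp: lifts_def)

text \<open>Cycles need not be homogeneous here: the value at \<open>N\<close> only sees the component of degree \<open>card N\<close>.
  The index set \<open>N\<close> is arbitrary so that generators can be adjoined and dropped freely.\<close>

definition kitt_top :: "nat set \<Rightarrow> (nat \<Rightarrow> 'a) \<Rightarrow> 'a set \<Rightarrow> 'a set" where
  "kitt_top N f \<aa> = (\<lambda>x. x N) ` koszul_alg N f (lifts N f \<aa>)"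

lemma fzero_cycle: "f \<in> fns \<Longrightarrow> fzero \<in> cycles N f"
  using linop_zero[OF linop_kdiff] unfolding cycles_def by (blast intro: ext_alg_fzero)

lemma ideal_kitt_top:
  assumes f: "f \<in> fns"
  shows "ideal (kitt_top N f \<aa>) R"
proof (rule idealI_cring)
  note V = lifts_subset[of N f \<aa>]
  show "kitt_top N f \<aa> \<subseteq> carrier R"
    using koszul_alg_fns[OF V] by (auto simp: kitt_top_def)
  show "\<zero> \<in> kitt_top N f \<aa>"
    using koszul_alg.cycle[OF fzero_cycle[OF f], of N "lifts N f \<aa>"]
    unfolding kitt_top_def by (metis image_eqI fun_ops_apply(4))
  show "a \<oplus> b \<in> kitt_top N f \<aa>" if "a \<in> kitt_top N f \<aa>" "b \<in> kitt_top N f \<aa>" for a b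
  proof -
    obtain x where x: "a = x N" "x \<in> koszul_alg N f (lifts N f \<aa>)"
      using \<open>a \<in> kitt_top N f \<aa>\<close> by (auto simp: kitt_top_def)
    obtain y where y: "b = y N" "y \<in> koszul_alg N f (lifts N f \<aa>)"
      using \<open>b \<in> kitt_top N f \<aa>\<close> unfolding kitt_top_def by (rule imageE)
    show ?thesis
      unfolding kitt_top_def by (rule image_eqI[OF _ koszul_alg.add[OF x(2) y(2)]]) (simp add: x y)
  qed
  show "a \<otimes> b \<in> kitt_top N f \<aa>" if "a \<in> carrier R" "b \<in> kitt_top N f \<aa>" for a b
  proof -
    obtain x where x: "b = x N" "x \<in> koszul_alg N f (lifts N f \<aa>)"
      using \<open>b \<in> kitt_top N f \<aa>\<close> unfolding kitt_top_def by (rule imageE)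
    show ?thesis
      unfolding kitt_top_def by (rule image_eqI[OF _ koszul_alg_fsmult[OF V f \<open>a \<in> carrier R\<close> x(2)]]) (simp add: x)
  qed
qed

section \<open>Independence of the matrix\<close>

text \<open>The degree-one cycle anticommutes past the factors from V until it meets a cycle, and
  the product of two cycles is a cycle.\<close>

lemma koszul_alg_ext_mult_cycle:
  assumes N: "finite N" and f: "f \<in> fns" and V: "V \<subseteq> fns"
    and w: "w \<in> fns" "pairing N w f = \<zero>" and x: "x \<in> koszul_alg N f V"
  shows "ext_mult N w x \<in> koszul_alg N f V"
  using x
proof induction
  case (cycle z)
  then show ?case by (intro koszul_alg.cycle cycles_ext_mult assms)
next
  case (add x y)
  then show ?case
    using linopD(2)[OF linop_ext_mult[OF w(1)]] koszul_alg_fns[OF V] koszul_alg.add by metis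
next
  case (mult v x)
  have "ext_mult N w (ext_mult N v x) = fneg (ext_mult N v (ext_mult N w x))"
    using V mult koszul_alg_fns[OF V] by (intro ext_mult_anticommute N w) auto
  then show ?case
    using koszul_alg_fneg[OF V f koszul_alg.mult[OF mult(1,3)]] by metis
qed

lemma koszul_alg_lifts:
  assumes N: "finite N" and f: "f \<in> fns" and V: "V \<subseteq> fns"
  shows "koszul_alg N f (lifts N f (genideal R ((\<lambda>v. pairing N v f) ` V))) = koszul_alg N f V"
    (is "koszul_alg N f ?W = _")
proof (intro equalityI subsetI)
  have P: "(\<lambda>v. pairing N v f) ` V \<subseteq> carrier R" using V f by auto
  have VW: "V \<subseteq> ?W" using V genideal_self[OF P] by (auto simp: lifts_def)
  show "x \<in> koszul_alg N f ?W" if "x \<in> koszul_alg N f V" for x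
    using that by induction (use VW in \<open>blast intro: koszul_alg.intros\<close>)+
  \<comment> \<open>\<open>?B\<close> collects the boundaries of degree-one elements that preserve
    the algebra. It is an ideal containing the boundaries of V, hence contains the ideal they
    generate, with no explicit linear combinations.\<close>
  let ?B = "{b \<in> carrier R. \<exists>v\<in>fns. pairing N v f = b \<and>
               (\<forall>x\<in>koszul_alg N f V. ext_mult N v x \<in> koszul_alg N f V)}"
  note fns = koszul_alg_fns[OF V]
  have "ideal ?B R"
  proof (rule idealI_cring)
    show "?B \<subseteq> carrier R" by auto
    have "pairing N fzero f = \<zero>" using f by (simp add: pairing_comm[of fzero] pairing_zero)
    then have "fzero \<in> fns \<and> pairing N fzero f = \<zero> \<and> (\<forall>x\<in>koszul_alg N f V. ext_mult N fzero x \<in> koszul_alg N f V)"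
      using koszul_alg_ext_mult_cycle[OF N f V] by simp
    then show "\<zero> \<in> ?B" by blast
    fix a b assume b: "b \<in> ?B"
    then obtain w where w: "w \<in> fns" "pairing N w f = b"
        "\<forall>x\<in>koszul_alg N f V. ext_mult N w x \<in> koszul_alg N f V"
      by blast
    show "a \<oplus> b \<in> ?B" if a: "a \<in> ?B"
    proof -
      obtain v where v: "v \<in> fns" "pairing N v f = a"
        "\<forall>x\<in>koszul_alg N f V. ext_mult N v x \<in> koszul_alg N f V"
        using a by blast
      have "fadd v w \<in> fns" "pairing N (fadd v w) f = a \<oplus> b"
        using v w f by (simp_all add: pairing_fadd)
      moreover have "ext_mult N (fadd v w) x \<in> koszul_alg N f V" if "x \<in> koszul_alg N f V" for x
        unfolding ext_mult_fadd[OF v(1) w(1) fns[OF that]] using v w that by (intro koszul_alg.add) auto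
      ultimately show ?thesis using a b by blast
    qed
    show "a \<otimes> b \<in> ?B" if a: "a \<in> carrier R"
    proof -
      have "fsmult a w \<in> fns" "pairing N (fsmult a w) f = a \<otimes> b"
        using a w f by (simp_all add: pairing_fsmult)
      moreover have "ext_mult N (fsmult a w) x \<in> koszul_alg N f V" if "x \<in> koszul_alg N f V" for x
        unfolding ext_mult_fsmult[OF w(1) a fns[OF that]] using a w that by (intro koszul_alg_fsmult V f) auto
      ultimately show ?thesis using a b by blast
    qed
  qed
  moreover have "(\<lambda>v. pairing N v f) ` V \<subseteq> ?B"
    using P V by (auto intro: koszul_alg.mult)
  ultimately have B: "genideal R ((\<lambda>v. pairing N v f) ` V) \<subseteq> ?B" by (rule genideal_minimal)
  show "x \<in> koszul_alg N f V" if "x \<in> koszul_alg N f ?W" for x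
    using that
  proof induction
    case (mult v x)
    then obtain w where w: "w \<in> fns" "pairing N w f = pairing N v f"
        "\<forall>x\<in>koszul_alg N f V. ext_mult N w x \<in> koszul_alg N f V"
      using B by (auto simp: lifts_def)
    have v: "v \<in> fns" using mult(1) lifts_subset by blast
    let ?z = "fadd v (fneg w)"
    have z: "?z \<in> fns" using v w by simp
    have "pairing N ?z f = pairing N v f \<oplus> pairing N (fneg w) f"
      using v w f by (intro pairing_fadd) simp_all
    then have "pairing N ?z f = \<zero>"
      using v w f by (simp add: pairing_fneg r_neg)
    then have "ext_mult N ?z x \<in> koszul_alg N f V"
      using koszul_alg_ext_mult_cycle[OF N f V z _ mult(3)] by simp
    moreover have "v = fadd w ?z" using v w by (simp add: fun_eq_iff r_neg2 a_lcomm r_neg)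
    then have "ext_mult N v x = fadd (ext_mult N w x) (ext_mult N ?z x)"
      using ext_mult_fadd[OF w(1) z fns[OF mult(3)]] by simp
    ultimately show ?case using w(3) mult(3) koszul_alg.add by metis
  qed (blast intro: koszul_alg.intros)+
qed

lemma kitt_top_cong:
  assumes "\<And>i. i \<in> N \<Longrightarrow> f i = g i" "f \<in> fns" "g \<in> fns"
  shows "kitt_top N f \<aa> = kitt_top N g \<aa>"
proof -
  have "cycles N f = cycles N g"
    using kdiff_cong[of N f g] assms by (auto simp: cycles_def ext_alg_def)
  moreover have "lifts N f \<aa> = lifts N g \<aa>"
    using pairing_cong[of N _ _ f g] assms by (auto simp: lifts_def)
  moreover have "koszul_alg N f V = koszul_alg N g V" if "cycles N f = cycles N g" for V
  proof (intro equalityI subsetI)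
    show "x \<in> koszul_alg N g V" if "x \<in> koszul_alg N f V" for x
      using that by induction (use \<open>cycles N f = cycles N g\<close> in \<open>blast intro: koszul_alg.intros\<close>)+
    show "x \<in> koszul_alg N f V" if "x \<in> koszul_alg N g V" for x
      using that by induction (use \<open>cycles N f = cycles N g\<close> in \<open>blast intro: koszul_alg.intros\<close>)+
  qed
  ultimately show ?thesis by (simp add: kitt_top_def)
qed

lemma genideal_pairing:
  assumes N: "finite N" and f: "f \<in> fns"
  shows "genideal R (f ` N) = {pairing N v f | v. v \<in> fns}" (is "_ = ?I")
proof
  have fN: "f ` N \<subseteq> carrier R" using f by auto
  interpret J: ideal "genideal R (f ` N)" R by (rule genideal_ideal[OF fN])
  have "ideal ?I R"
  proof (rule idealI_cring)
    show "?I \<subseteq> carrier R" using f by auto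
    have "pairing N fzero f = \<zero>" using f by (simp add: pairing_comm[of fzero] pairing_zero)
    moreover have "fzero \<in> fns" by simp
    ultimately show "\<zero> \<in> ?I" by (smt (verit) mem_Collect_eq)
    fix a b assume "b \<in> ?I"
    then obtain w where w: "w \<in> fns" "b = pairing N w f" by blast
    show "a \<oplus> b \<in> ?I" if a: "a \<in> ?I"
    proof -
      obtain v where v: "v \<in> fns" "a = pairing N v f" using a by blast
      have "fadd v w \<in> fns" "pairing N (fadd v w) f = a \<oplus> b"
        using v w f by (simp_all add: pairing_fadd)
      then show ?thesis by (smt (verit) mem_Collect_eq)
    qed
    show "a \<otimes> b \<in> ?I" if a: "a \<in> carrier R"
    proof -
      have "fsmult a w \<in> fns" "pairing N (fsmult a w) f = a \<otimes> b"
        using a w f by (simp_all add: pairing_fsmult)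
      then show ?thesis by (smt (verit) mem_Collect_eq)
    qed
  qed
  moreover have "f ` N \<subseteq> ?I"
  proof (rule image_subsetI)
    fix i assume i: "i \<in> N"
    let ?v = "\<lambda>j. if i = j then \<one> else \<zero>"
    have "pairing N ?v f = (\<Oplus>j\<in>N. if i = j then f j else \<zero>)"
      unfolding pairing_def using f by (intro finsum_cong') auto
    then have "pairing N ?v f = f i" using N f i by (simp add: finsum_singleton[of i N f])
    moreover have "?v \<in> fns" by simp
    ultimately show "f i \<in> ?I" by (smt (verit) mem_Collect_eq)
  qed
  ultimately show "genideal R (f ` N) \<subseteq> ?I" by (rule genideal_minimal)
  have "pairing M v f \<in> genideal R (f ` N)" if v: "v \<in> fns" and "M \<subseteq> N" for v M
    using finite_subset[OF that(2) N] that(2)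
  proof induction
    case empty
    then show ?case by simp
  next
    case (insert i M)
    moreover have "f i \<in> genideal R (f ` N)"
      using genideal_self[OF fN] insert.prems by auto
    ultimately show ?case using v f by (auto intro!: J.a_closed J.I_l_closed)
  qed
  then show "?I \<subseteq> genideal R (f ` N)" by blast
qed

subsection \<open>Independence of the generators\<close>

text \<open>With the degree-one cycle \<open>\<eta> = e\<^sub>m - \<Sum> b\<^sub>i e\<^sub>i\<close> one has \<open>K' = K \<oplus> \<eta> K\<close> as complexes, and likewise for the subalgebras.\<close>

lemma kitt_top_insert:
  assumes N: "finite N" and m: "m \<notin> N" and f: "f \<in> fns" and \<aa>: "ideal \<aa> R"
    and fm: "f m \<in> genideal R (f ` N)"
  shows "kitt_top (insert m N) f \<aa> = kitt_top N f \<aa>"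
proof -
  interpret \<aa>: ideal \<aa> R by fact
  let ?N = "insert m N"
  have N': "finite ?N" using N by simp
  obtain b where b: "b \<in> fns" "f m = pairing N b f"
    using fm genideal_pairing[OF N f] by auto
  define \<eta> where "\<eta> = (\<lambda>i. if i = m then \<one> else \<ominus> b i)"
  have \<eta>: "\<eta> \<in> fns" "\<eta> m = \<one>" using b by (simp_all add: \<eta>_def)
  have "pairing N \<eta> f = pairing N (fneg b) f"
    using m b f by (intro pairing_cong) (auto simp: \<eta>_def)
  then have d\<eta>: "pairing ?N \<eta> f = \<zero>"
    using N m \<eta> f b by (simp add: pairing_fneg r_neg)
  define L where "L = ext_mult ?N \<eta>"
  have L: "linop L" using \<eta> by (simp add: L_def)
  have L_alg: "L y \<in> ext_alg ?N" if "y \<in> ext_alg N" for y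
    using that \<eta> ext_alg_mono[of N ?N] unfolding L_def by (intro ext_alg_ext_mult) auto
  \<comment> \<open>The coordinate of \<eta> at m is 1, so contraction by e_m undoes multiplication
    by \<eta> on elements free of e_m. This makes the decomposition x + \<eta> y unique.\<close>
  have ann_L: "ann m (L y) = y" if "y \<in> ext_alg N" for y
  proof -
    have "ann m y = fzero" by (rule ann_ext_alg[OF m that])
    then have "L (ann m y) = fzero" using linop_zero[OF L] by simp
    moreover have "ann m (L y) = fadd (fsmult (\<eta> m) y) (fneg (L (ann m y)))"
      using ann_ext_mult[OF N' \<eta>(1), of y m] ext_algD(1)[OF that] by (simp add: L_def)
    ultimately show ?thesis using \<eta>(2) ext_algD[OF that] by (simp add: fun_eq_iff)
  qed
  have ann_fadd: "ann m (fadd x y) = fadd (ann m x) (ann m y)" if "x \<in> fns" "y \<in> fns" for x y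
    using that by (intro linopD(2)) simp_all
  have ann_sum: "ann m (fadd x (L y)) = y" if x: "x \<in> ext_alg N" and y: "y \<in> ext_alg N" for x y
    using ann_fadd[OF ext_algD(1)[OF x] linopD(1)[OF L ext_algD(1)[OF y]]]
      ann_ext_alg[OF m x] ann_L[OF y] ext_algD[OF y]
    by (simp add: fun_eq_iff)
  \<comment> \<open>The second part is forced to be \<open>ann m w\<close>; what remains is killed
    by the contraction and hence free of e_m.\<close>
  have decompose: "\<exists>x\<in>ext_alg N. \<exists>y\<in>ext_alg N. w = fadd x (L y)" if w: "w \<in> ext_alg ?N" for w
  proof -
    let ?y = "ann m w" let ?x = "fadd w (fneg (L ?y))"
    have y: "?y \<in> ext_alg N"
      using ext_alg_ann[OF w] ann_ann_self[OF ext_algD(1)[OF w]] by (rule ext_alg_insertD)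
    note Ly = L_alg[OF y]
    have "ann m (fneg (L ?y)) = fneg (ann m (L ?y))"
      using ext_algD(1)[OF Ly] by (intro linop_neg) simp_all
    then have "ann m ?x = fadd ?y (fneg ?y)"
      using ann_fadd[OF ext_algD(1)[OF w] ext_algD(1)[OF ext_alg_fneg[OF Ly]]] ann_L[OF y] by simp
    then have "ann m ?x = fzero" using ext_algD[OF y] by (simp add: fun_eq_iff r_neg)
    then have "?x \<in> ext_alg N"
      by (rule ext_alg_insertD[OF ext_alg_fadd[OF w ext_alg_fneg[OF Ly]]])
    moreover have "w = fadd ?x (L ?y)"
      using ext_algD[OF w] ext_algD[OF Ly] by (simp add: fun_eq_iff a_assoc l_neg)
    ultimately show ?thesis using y by blast
  qed
  have kdiff_N: "kdiff ?N f x = kdiff N f x" if x: "x \<in> ext_alg N" for x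
    using ann_ext_alg[OF m x] ext_algD[OF x] f N m by (simp add: kdiff_insert fun_eq_iff)
  have kdiff_L: "kdiff ?N f (L y) = fneg (L (kdiff N f y))" if y: "y \<in> ext_alg N" for y
  proof -
    have "kdiff ?N f (L y) = fadd (fsmult \<zero> y) (fneg (L (kdiff N f y)))"
      using kdiff_ext_mult[OF N' N' order_refl \<eta>(1) f ext_algD(1)[OF y]]
      unfolding L_def kdiff_N[OF y] d\<eta> .
    then show ?thesis
      using ext_algD[OF y] ext_algD(2)[OF L_alg[OF ext_alg_kdiff[OF f y]]] by (simp add: fun_eq_iff)
  qed
  let ?W = "lifts N f \<aa>" let ?W' = "lifts ?N f \<aa>"
  let ?A = "koszul_alg N f ?W" let ?A' = "koszul_alg ?N f ?W'"
  note sub = koszul_alg_subset[OF lifts_subset[of N f \<aa>]]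
  note fns = koszul_alg_fns[OF lifts_subset[of N f \<aa>]]
  have fzeroA: "fzero \<in> ?A" using f by (intro koszul_alg.cycle fzero_cycle)
  have Lzero: "L fzero = fzero" by (rule linop_zero[OF L])
  have split: "\<exists>x\<in>?A. \<exists>y\<in>?A. w = fadd x (L y)" if "w \<in> ?A'" for w
    using that
  proof induction
    case (cycle z)
    obtain x y where x: "x \<in> ext_alg N" and y: "y \<in> ext_alg N" and z: "z = fadd x (L y)"
      using decompose[OF cyclesD(1)[OF cycle]] by blast
    let ?dx = "kdiff N f x" let ?dy = "kdiff N f y"
    have dx: "?dx \<in> ext_alg N" and dy: "?dy \<in> ext_alg N"
      using f x y by (simp_all add: ext_alg_kdiff)
    have "kdiff ?N f z = fadd (kdiff ?N f x) (kdiff ?N f (L y))"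
      unfolding z using f x y L_alg[OF y] by (intro linopD(2)) (simp_all add: ext_algD)
    also have "\<dots> = fadd ?dx (fneg (L ?dy))"
      by (simp only: kdiff_N[OF x] kdiff_L[OF y])
    also have "fneg (L ?dy) = L (fneg ?dy)"
      using linop_neg[OF L ext_algD(1)[OF dy]] by simp
    finally have eq: "fadd ?dx (L (fneg ?dy)) = fzero"
      using cyclesD(3)[OF cycle] by metis
    \<comment> \<open>Uniqueness applied to \<open>eq\<close>: both parts of a cycle are cycles
      separately.\<close>
    have "fneg ?dy = fzero"
      using ann_sum[OF dx ext_alg_fneg[OF dy]] unfolding eq
      using linop_zero[OF linop_ann[of m]] by simp
    then have "fneg (fneg ?dy) = fneg fzero" by simp
    then have dy0: "?dy = fzero" using ext_algD[OF dy] by (simp add: fun_eq_iff)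
    have "?dx = fzero"
      using eq ext_algD(2)[OF dx] unfolding \<open>fneg ?dy = fzero\<close> Lzero by (simp add: fun_eq_iff)
    then have "x \<in> ?A" "y \<in> ?A"
      using x y dy0 by (auto intro!: koszul_alg.cycle simp: cycles_def)
    then show ?case using z by blast
  next
    case (add w1 w2)
    then obtain x1 y1 x2 y2 where *: "x1 \<in> ?A" "y1 \<in> ?A" "w1 = fadd x1 (L y1)"
      "x2 \<in> ?A" "y2 \<in> ?A" "w2 = fadd x2 (L y2)" by blast
    have "L (fadd y1 y2) = fadd (L y1) (L y2)"
      using * fns by (intro linopD(2)[OF L]) blast+
    then have "fadd w1 w2 = fadd (fadd x1 x2) (L (fadd y1 y2))"
      using * fns linop_closed[OF L] by (simp add: fun_eq_iff a_ac)
    moreover have "fadd x1 x2 \<in> ?A" "fadd y1 y2 \<in> ?A"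
      using * koszul_alg.add by blast+
    ultimately show ?case by blast
  next
    case (mult v w)
    then obtain x y where x: "x \<in> ?A" and y: "y \<in> ?A" and w: "w = fadd x (L y)" by blast
    have v: "v \<in> fns" "pairing ?N v f \<in> \<aa>" using mult(1) by (simp_all add: lifts_def)
    \<comment> \<open>Subtracting v_m \<eta> clears the coordinate at m without changing the
      boundary, so \<open>?u\<close> is a lift over N. With \<eta> squaring to zero, the product
      becomes u x + \<eta> (v_m x - u y).\<close>
    let ?u = "fadd v (fsmult (\<ominus> v m) \<eta>)"
    have u: "?u \<in> fns" using v \<eta> by simp
    have um: "?u m = \<zero>" using v \<eta> by (simp add: r_neg)
    have "pairing ?N ?u f = pairing ?N v f"
      using v \<eta> f d\<eta> by (simp add: pairing_fadd pairing_fsmult)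
    moreover have "pairing ?N ?u f = pairing N ?u f"
      using pairing_insert[OF N m u f] um f u by simp
    ultimately have uW: "?u \<in> ?W" using v u by (simp add: lifts_def)
    let ?U = "ext_mult N ?u"
    have U': "ext_mult ?N ?u t = ?U t" if t: "t \<in> fns" for t
      using ext_mult_insert[OF N m u t] um t linop_closed[OF linop_ext_mult[OF u] t]
      by (simp add: fun_eq_iff)
    have xf: "x \<in> fns" and yf: "y \<in> fns" using fns x y by blast+
    have wf: "w \<in> fns" using w xf yf linop_closed[OF L yf] by simp
    have "v = fadd ?u (fsmult (v m) \<eta>)"
      using v \<eta> by (simp add: fun_eq_iff a_assoc l_minus l_neg)
    then have "ext_mult ?N v w = fadd (ext_mult ?N ?u w) (fsmult (v m) (L w))"
      using ext_mult_fadd[OF u _ wf, of "fsmult (v m) \<eta>" ?N] ext_mult_fsmult[OF \<eta>(1) _ wf, of "v m" ?N] v \<eta>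
      by (simp add: L_def)
    also have "ext_mult ?N ?u w = fadd (?U x) (fneg (L (?U y)))"
    proof -
      have "ext_mult ?N ?u w = fadd (ext_mult ?N ?u x) (ext_mult ?N ?u (L y))"
        unfolding w using xf linopD(1)[OF L yf] u by (intro linopD(2) linop_ext_mult)
      also have "ext_mult ?N ?u (L y) = fneg (L (ext_mult ?N ?u y))"
        unfolding L_def by (rule ext_mult_anticommute[OF N' u \<eta>(1) yf])
      finally show ?thesis unfolding U'[OF xf] U'[OF yf] .
    qed
    also have "L w = L x"
    proof -
      have "L w = fadd (L x) (L (L y))"
        unfolding w using xf yf linopD(1)[OF L yf] by (intro linopD(2) L)
      moreover have "L (L y) = fzero"
        unfolding L_def by (rule ext_mult_self[OF N' \<eta>(1) yf])
      ultimately show ?thesis using linop_closed[OF L xf] by (simp add: fun_eq_iff)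
    qed
    finally have "ext_mult ?N v w = fadd (fadd (?U x) (fneg (L (?U y)))) (fsmult (v m) (L x))" .
    moreover have "L (fadd (fsmult (v m) x) (fneg (?U y))) = fadd (fsmult (v m) (L x)) (fneg (L (?U y)))"
    proof -
      have Uy: "?U y \<in> fns" using u yf by (intro linopD(1)[OF linop_ext_mult])
      have "L (fadd (fsmult (v m) x) (fneg (?U y))) = fadd (L (fsmult (v m) x)) (L (fneg (?U y)))"
        using xf v Uy by (intro linopD(2)[OF L]) simp_all
      then show ?thesis
        using linopD(3)[OF L xf, of "v m"] linop_neg[OF L Uy] v by simp
    qed
    ultimately have "ext_mult ?N v w = fadd (?U x) (L (fadd (fsmult (v m) x) (fneg (?U y))))"
      using linop_closed[OF L] linop_closed[OF linop_ext_mult[OF u]] xf yf v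
      by (simp add: fun_eq_iff a_ac)
    moreover have "?U x \<in> ?A" "fadd (fsmult (v m) x) (fneg (?U y)) \<in> ?A"
      using x y v uW f by (auto intro!: koszul_alg.add koszul_alg.mult koszul_alg_fsmult koszul_alg_fneg lifts_subset)
    ultimately show ?case by blast
  qed
  have incl: "x \<in> ?A'" if "x \<in> ?A" for x
    using that
  proof induction
    case (cycle z)
    have "z \<in> cycles ?N f"
      using cyclesD[OF cycle] kdiff_N[of z] ext_alg_mono[of N ?N] by (auto simp: cycles_def)
    then show ?case by (rule koszul_alg.cycle)
  next
    case (add x y)
    then show ?case by (intro koszul_alg.add)
  next
    case (mult v x)
    \<comment> \<open>A lift over N may take any value at m, but the product over the larger index
      set reads that value, so it is reset to zero.\<close>
    let ?v = "v(m := \<zero>)"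
    have v: "v \<in> fns" "pairing N v f \<in> \<aa>" using mult(1) by (simp_all add: lifts_def)
    have v': "?v \<in> fns" using v by simp
    have "pairing N ?v f = pairing N v f"
      using m v f by (intro pairing_cong) auto
    then have "?v \<in> ?W'" using N m v v' f by (simp add: lifts_def)
    moreover have "ext_mult ?N ?v x = ext_mult N v x"
    proof -
      have xf: "x \<in> fns" using mult fns by blast
      have "ext_mult N ?v x = ext_mult N v x"
        using m v xf by (intro ext_mult_cong) auto
      then show ?thesis
        using ext_mult_insert[OF N m v' xf] v xf by (simp add: fun_eq_iff)
    qed
    ultimately show ?case using mult(3) koszul_alg.mult by metis
  qed
  have \<eta>W: "\<eta> \<in> ?W'" using \<eta> d\<eta> by (simp add: lifts_def)
  \<comment> \<open>Only the part \<eta> y reaches the full index set, and there contraction by e_m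
    reads off y at N up to sign.\<close>
  have top: "fadd x (L y) ?N = ext_sgn R (below m N) \<otimes> y N" if x: "x \<in> ?A" and y: "y \<in> ?A" for x y
  proof -
    have "ann m (fadd x (L y)) N = y N" using ann_sum[OF sub[OF x] sub[OF y]] by simp
    then have "ext_sgn R (below m N) \<otimes> fadd x (L y) ?N = y N"
      using m unfolding ann_def by simp
    then have "ext_sgn R (below m N) \<otimes> (ext_sgn R (below m N) \<otimes> fadd x (L y) ?N) = ext_sgn R (below m N) \<otimes> y N"
      by simp
    then show ?thesis
      using fns[OF x] linop_closed[OF L fns[OF y]] by simp
  qed
  interpret T: ideal "kitt_top N f \<aa>" R by (rule ideal_kitt_top[OF f])
  show ?thesis
  proof (intro equalityI subsetI)
    fix a assume "a \<in> kitt_top ?N f \<aa>"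
    then obtain w where w: "w \<in> ?A'" "a = w ?N" unfolding kitt_top_def by blast
    then obtain x y where x: "x \<in> ?A" and y: "y \<in> ?A" and "w = fadd x (L y)" using split by blast
    then have "a = ext_sgn R (below m N) \<otimes> y N" using w top by simp
    moreover have "y N \<in> kitt_top N f \<aa>" using y unfolding kitt_top_def by blast
    ultimately show "a \<in> kitt_top N f \<aa>" using T.I_l_closed by simp
  next
    fix a assume "a \<in> kitt_top N f \<aa>"
    then obtain y where y: "y \<in> ?A" "a = y N" unfolding kitt_top_def by blast
    let ?y = "fsmult (ext_sgn R (below m N)) y"
    have yA: "?y \<in> ?A" using y by (intro koszul_alg_fsmult lifts_subset f) simp_all
    have "fadd fzero (L ?y) ?N = a"
      using top[OF fzeroA yA] y fns[OF y(1)] by simp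
    moreover have "L ?y \<in> ?A'" unfolding L_def by (rule koszul_alg.mult[OF \<eta>W incl[OF yA]])
    then have "fadd fzero (L ?y) \<in> ?A'" by (rule koszul_alg.add[OF incl[OF fzeroA]])
    ultimately show "a \<in> kitt_top ?N f \<aa>" unfolding kitt_top_def by blast
  qed
qed

lemma kitt_top_Un:
  assumes "finite M" "finite N" "M \<inter> N = {}" "f \<in> fns" "ideal \<aa> R" "f ` M \<subseteq> genideal R (f ` N)"
  shows "kitt_top (M \<union> N) f \<aa> = kitt_top N f \<aa>"
  using assms
proof (induction M)
  case (insert m M)
  have "genideal R (f ` N) \<subseteq> genideal R (f ` (M \<union> N))"
    unfolding genideal_def by (intro Inter_anti_mono) auto
  then have "kitt_top (insert m (M \<union> N)) f \<aa> = kitt_top (M \<union> N) f \<aa>"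
    using insert by (intro kitt_top_insert) auto
  then show ?case using insert by simp
qed simp

lemma kitt_top_eq_disjoint:
  assumes "finite M" "finite N" "M \<inter> N = {}" "f \<in> fns" "g \<in> fns" "ideal \<aa> R"
    and eq: "genideal R (f ` M) = genideal R (g ` N)"
  shows "kitt_top M f \<aa> = kitt_top N g \<aa>"
proof -
  define h where "h = (\<lambda>i. if i \<in> M then f i else g i)"
  have h: "h \<in> fns" using assms by (simp add: h_def)
  have M: "h ` M = f ` M" and N: "h ` N = g ` N" using assms(3) by (auto simp: h_def)
  have "f ` M \<subseteq> genideal R (f ` M)" "g ` N \<subseteq> genideal R (g ` N)"
    using assms by (intro genideal_self; auto)+
  then have "kitt_top (M \<union> N) h \<aa> = kitt_top N h \<aa>" "kitt_top (N \<union> M) h \<aa> = kitt_top M h \<aa>"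
    using assms M N h by (intro kitt_top_Un; auto)+
  moreover have "kitt_top M h \<aa> = kitt_top M f \<aa>" "kitt_top N h \<aa> = kitt_top N g \<aa>"
    using assms h by (intro kitt_top_cong; auto simp: h_def)+
  ultimately show ?thesis by (simp add: Un_commute)
qed

text \<open>Overlapping index sets are handled by moving one family to fresh indices.\<close>

lemma kitt_top_eq:
  assumes "finite M" "finite N" "f \<in> fns" "g \<in> fns" "ideal \<aa> R"
    and eq: "genideal R (f ` M) = genideal R (g ` N)"
  shows "kitt_top M f \<aa> = kitt_top N g \<aa>"
proof -
  \<comment> \<open>A shift past every index in use; inserting 0 keeps \<open>Max\<close> meaningful
    when both sets are empty.\<close>
  define k where "k = Suc (Max (insert 0 (M \<union> N)))"
  have k: "i < k" if "i \<in> M \<union> N" for i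
    using that assms by (auto simp: k_def less_Suc_eq_le)
  let ?P = "(+) k ` M" and ?h = "\<lambda>i. f (i - k)"
  have h: "?h \<in> fns" "?h ` ?P = f ` M" using assms by (auto simp: image_image)
  have "?P \<inter> M = {}" "?P \<inter> N = {}" using k by force+
  then have "kitt_top ?P ?h \<aa> = kitt_top M f \<aa>" "kitt_top ?P ?h \<aa> = kitt_top N g \<aa>"
    using assms h by (intro kitt_top_eq_disjoint; simp)+
  then show ?thesis by simp
qed

subsection \<open>Comparison with the wedge product of coefficient functions\<close>

lemma linop_ext_wedge:
  assumes z: "z \<in> fns"
  shows "linop (\<lambda>x. ext_wedge R r x z)"
  unfolding linop_def
proof (intro conjI ballI)
  fix x :: "nat set \<Rightarrow> 'a"
  assume x: "x \<in> fns"
  show "ext_wedge R r x z \<in> fns"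
    using x z by (simp add: ext_wedge_def finsum_closed Pi_iff)
  show "ext_wedge R r (fadd x y) z = fadd (ext_wedge R r x z) (ext_wedge R r y z)"
    if y: "y \<in> fns" for y
  proof
    fix U
    have "(\<Oplus>S\<in>Pow U. ext_sgn R (ext_inv S (U - S)) \<otimes> (x S \<oplus> y S) \<otimes> z (U - S)) =
      (\<Oplus>S\<in>Pow U. ext_sgn R (ext_inv S (U - S)) \<otimes> x S \<otimes> z (U - S) \<oplus>
                  ext_sgn R (ext_inv S (U - S)) \<otimes> y S \<otimes> z (U - S))"
      using x y z by (intro finsum_cong') (auto simp: r_distr l_distr)
    then show "ext_wedge R r (fadd x y) z U = fadd (ext_wedge R r x z) (ext_wedge R r y z) U"
      using x y z by (simp add: ext_wedge_def finsum_addf Pi_iff)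
  qed
  show "ext_wedge R r (fsmult a x) z = fsmult a (ext_wedge R r x z)" if a: "a \<in> carrier R" for a
  proof
    fix U
    show "ext_wedge R r (fsmult a x) z U = fsmult a (ext_wedge R r x z) U"
    proof (cases "U \<subseteq> {..<r}")
      case True
      then have "finite (Pow U)" using finite_subset by auto
      then have "a \<otimes> (\<Oplus>S\<in>Pow U. ext_sgn R (ext_inv S (U - S)) \<otimes> x S \<otimes> z (U - S)) =
        (\<Oplus>S\<in>Pow U. a \<otimes> (ext_sgn R (ext_inv S (U - S)) \<otimes> x S \<otimes> z (U - S)))"
        using x a z by (intro finsum_rdistr) auto
      also have "\<dots> = (\<Oplus>S\<in>Pow U. ext_sgn R (ext_inv S (U - S)) \<otimes> (a \<otimes> x S) \<otimes> z (U - S))"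
        using x a z by (intro finsum_cong') (auto simp: m_ac)
      finally show ?thesis using True by (simp add: ext_wedge_def)
    qed (use a in \<open>simp add: ext_wedge_def\<close>)
  qed
qed

lemma ext_wedge_cre:
  assumes i: "i < r" and x: "x \<in> fns" and z: "z \<in> fns"
  shows "ext_wedge R r (cre i x) z = cre i (ext_wedge R r x z)"
proof
  fix U
  show "ext_wedge R r (cre i x) z U = cre i (ext_wedge R r x z) U"
  proof (cases "U \<subseteq> {..<r}")
    case U: True
    then have fin: "finite U" using finite_subset by blast
    show ?thesis
    proof (cases "i \<in> U")
      case True
      let ?V = "U - {i}"
      let ?F = "\<lambda>S. ext_sgn R (ext_inv S (U - S)) \<otimes> cre i x S \<otimes> z (U - S)"
      have V: "?V \<subseteq> {..<r}" using U by auto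
      have "(\<Oplus>S\<in>Pow U. ?F S) = (\<Oplus>S\<in>insert i ` Pow ?V. ?F S)"
      proof (rule add.finprod_mono_neutral_cong_right)
        show "?F S = \<zero>" if S: "S \<in> Pow U - insert i ` Pow ?V" for S
        proof -
          have "i \<notin> S"
          proof
            assume "i \<in> S"
            then have "S = insert i (S - {i})" "S - {i} \<in> Pow ?V" using S by auto
            then show False using S by blast
          qed
          then show ?thesis using z by (simp add: cre_def)
        qed
      qed (use fin True x z in auto)
      also have "\<dots> = (\<Oplus>S\<in>Pow ?V. ?F (insert i S))"
        using x z by (intro finsum_reindex) (auto simp: inj_on_def)
      also have "\<dots> = (\<Oplus>S\<in>Pow ?V. ext_sgn R (below i U) \<otimes>
          (ext_sgn R (ext_inv S (?V - S)) \<otimes> x S \<otimes> z (?V - S)))"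
      proof (rule finsum_cong'[OF refl])
        fix S assume "S \<in> Pow ?V"
        then have S: "i \<notin> S" "S \<subseteq> ?V" by auto
        let ?T = "?V - S"
        have T: "U - insert i S = ?T" "insert i S - {i} = S" using S by auto
        have finST: "finite S" "finite ?T" using S fin finite_subset by auto
        have "U = insert i (S \<union> ?T)" using S True by auto
        then have "below i U = below i S + below i ?T"
          using S below_insert[of i "S \<union> ?T" i] below_Un[of S ?T i] by auto
        then show "?F (insert i S) = ext_sgn R (below i U) \<otimes>
          (ext_sgn R (ext_inv S ?T) \<otimes> x S \<otimes> z ?T)"
          using S x z by (simp add: T cre_def ext_inv_insert[OF finST] ext_sgn_add m_ac)
      qed (use x z in auto)
      also have "\<dots> = ext_sgn R (below i U) \<otimes>
          (\<Oplus>S\<in>Pow ?V. ext_sgn R (ext_inv S (?V - S)) \<otimes> x S \<otimes> z (?V - S))"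
        using x z fin by (intro finsum_rdistr[symmetric]) auto
      finally show ?thesis using U V True by (simp add: ext_wedge_def cre_def)
    next
      case False
      have "(\<Oplus>S\<in>Pow U. ext_sgn R (ext_inv S (U - S)) \<otimes> cre i x S \<otimes> z (U - S)) = (\<Oplus>S\<in>Pow U. \<zero>)"
        using False z by (intro finsum_cong') (auto simp: cre_def)
      then show ?thesis using U False by (simp add: ext_wedge_def cre_def finsum_zero)
    qed
  next
    case False
    then have "\<not> U - {i} \<subseteq> {..<r}" using i by auto
    then show ?thesis using False by (simp add: ext_wedge_def cre_def)
  qed
qed

lemma ext_wedge_ext_mult:
  assumes v: "v \<in> fns" and x: "x \<in> fns" and z: "z \<in> fns"
  shows "ext_wedge R r (ext_mult {..<r} v x) z = ext_mult {..<r} v (ext_wedge R r x z)"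
  unfolding ext_mult_def using v x z
  by (intro lincomb_commute[where T = "\<lambda>x. ext_wedge R r x z"] linop_ext_wedge ext_wedge_cre) simp_all

lemma ext_wedge_one:
  assumes z: "z \<in> ext_alg {..<r}"
  shows "ext_wedge R r (ext_one R) z = z"
proof
  fix U
  show "ext_wedge R r (ext_one R) z U = z U"
  proof (cases "U \<subseteq> {..<r}")
    case True
    then have "finite (Pow U)" using finite_subset by auto
    then have "(\<Oplus>S\<in>Pow U. ext_sgn R (ext_inv S (U - S)) \<otimes> ext_one R S \<otimes> z (U - S)) =
       (\<Oplus>S\<in>{{}}. z (U - S))"
      using ext_algD(1)[OF z] by (intro add.finprod_mono_neutral_cong_right) (auto simp: ext_one_def)
    then show ?thesis using True ext_algD(1)[OF z] by (simp add: ext_wedge_def)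
  qed (use ext_algD(3)[OF z] in \<open>simp add: ext_wedge_def\<close>)
qed

lemma ext_wedge_kzeta:
  assumes c: "\<And>i j. c i j \<in> carrier R" and x: "x \<in> ext_alg {..<r}"
  shows "ext_wedge R r (kzeta R r c j) x = ext_mult {..<r} (\<lambda>i. c i j) x"
proof
  fix U
  have "ext_one R \<in> fns" by (simp add: ext_one_def)
  have cfns: "(\<lambda>i. c i j) \<in> fns" using c by simp
  have one: "ext_one R \<in> ext_alg {..<r}" by (simp add: ext_alg_def ext_one_def)
  \<comment> \<open>Writing the column as a multiple of the unit reduces the claim to associativity
    and the unit law.\<close>
  have "kzeta R r c j = ext_mult {..<r} (\<lambda>i. c i j) (ext_one R)"
  proof
    fix S
    have *: "cre i (ext_one R) S = (if S = {i} then \<one> else \<zero>)" for i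
    proof -
      have "below i {i} = 0" by (simp add: below_def)
      moreover have "i \<in> S \<Longrightarrow> S - {i} = {} \<longleftrightarrow> S = {i}" by blast
      ultimately show ?thesis by (simp add: cre_def ext_one_def)
    qed
    show "kzeta R r c j S = ext_mult {..<r} (\<lambda>i. c i j) (ext_one R) S"
    proof (cases "\<exists>i<r. S = {i}")
      case True
      then obtain i where i: "i < r" "S = {i}" by blast
      have "pairing {..<r} (\<lambda>i. c i j) (\<lambda>k. cre k (ext_one R) S) = (\<Oplus>k\<in>{..<r}. if i = k then c k j else \<zero>)"
        unfolding pairing_def * using i c by (intro finsum_cong') auto
      also have "\<dots> = c i j"
        using i c by (intro finsum_singleton) auto
      finally show ?thesis
        using i by (simp add: ext_mult_def lincomb_eq_pairing kzeta_def)
    next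
      case False
      then have "kzeta R r c j S = \<zero>" by (auto simp: kzeta_def card_1_singleton_iff)
      moreover have "pairing {..<r} (\<lambda>i. c i j) (\<lambda>k. cre k (ext_one R) S) = \<zero>"
        using False cfns by (intro pairing_zero) (auto simp: *)
      ultimately show ?thesis by (simp add: ext_mult_def lincomb_eq_pairing)
    qed
  qed
  then show "ext_wedge R r (kzeta R r c j) x U = ext_mult {..<r} (\<lambda>i. c i j) x U"
    using ext_wedge_ext_mult[OF cfns \<open>ext_one R \<in> fns\<close> ext_algD(1)[OF x]] ext_wedge_one[OF x]
    by simp
qed

definition ext_mults :: "nat set \<Rightarrow> (nat \<Rightarrow> nat \<Rightarrow> 'a) \<Rightarrow> nat list \<Rightarrow> (nat set \<Rightarrow> 'a) \<Rightarrow> nat set \<Rightarrow> 'a" where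
  "ext_mults N c js x = foldr (\<lambda>j. ext_mult N (\<lambda>i. c i j)) js x"

lemma ext_mults_simps [simp]:
  "ext_mults N c [] x = x" "ext_mults N c (j # js) x = ext_mult N (\<lambda>i. c i j) (ext_mults N c js x)"
  "ext_mults N c (js @ [j]) x = ext_mults N c js (ext_mult N (\<lambda>i. c i j) x)"
  by (simp_all add: ext_mults_def)

lemma linop_ext_mults:
  assumes c: "\<And>i j. c i j \<in> carrier R"
  shows "linop (ext_mults N c js)"
proof (induction js)
  case (Cons j js)
  let ?E = "ext_mult N (\<lambda>i. c i j)"
  have E: "linop ?E" using c by (intro linop_ext_mult) simp
  have "ext_mults N c (j # js) = (\<lambda>x. ?E (ext_mults N c js x))" by (rule ext) simp
  then show ?case using linopD[OF E] linopD[OF Cons.IH] unfolding linop_def by metis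
qed (simp add: linop_def)

lemma ext_alg_ext_mults:
  assumes "\<And>i j. c i j \<in> carrier R" "x \<in> ext_alg N"
  shows "ext_mults N c js x \<in> ext_alg N"
  using assms by (induction js) (auto intro!: ext_alg_ext_mult)

lemma zeta_monomial_eq:
  assumes c: "\<And>i j. c i j \<in> carrier R"
  shows "zeta_monomial R r c js = ext_mults {..<r} c js (ext_one R)"
proof (induction js)
  case (Cons j js)
  have "ext_one R \<in> ext_alg {..<r}" by (simp add: ext_alg_def ext_one_def)
  then show ?case
    using Cons ext_wedge_kzeta[OF c ext_alg_ext_mults[OF c]] by (simp add: zeta_monomial_def)
qed (simp add: zeta_monomial_def)

lemma ext_wedge_zeta_monomial:
  assumes c: "\<And>i j. c i j \<in> carrier R" and z: "z \<in> ext_alg {..<r}"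
  shows "ext_wedge R r (zeta_monomial R r c js) z = ext_mults {..<r} c js z"
  unfolding zeta_monomial_eq[OF c]
proof (induction js)
  case Nil
  then show ?case using ext_wedge_one[OF z] by simp
next
  case (Cons j js)
  have "ext_one R \<in> ext_alg {..<r}" by (simp add: ext_alg_def ext_one_def)
  then have "ext_mults {..<r} c js (ext_one R) \<in> fns"
    by (rule ext_algD(1)[OF ext_alg_ext_mults[OF c]])
  then show ?case
    using Cons ext_wedge_ext_mult[OF _ _ ext_algD(1)[OF z], of "\<lambda>i. c i j" _ r] c by simp
qed

text \<open>Each factor raises the degree by one, so a coefficient in degree n sees only the
  component of degree n minus \<open>length js\<close>. In additive form the hypothesis is vacuous
  when there are more than n factors.\<close>

lemma ext_mults_cong_card:
  assumes c: "\<And>i j. c i j \<in> carrier R" and x: "x \<in> fns" and y: "y \<in> fns"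
  shows "finite U \<Longrightarrow> card U = n \<Longrightarrow> (\<And>S. finite S \<Longrightarrow> card S + length js = n \<Longrightarrow> x S = y S) \<Longrightarrow>
    ext_mults N c js x U = ext_mults N c js y U"
proof (induction js arbitrary: U n)
  case (Cons j js)
  have "cre i (ext_mults N c js x) U = cre i (ext_mults N c js y) U" for i
  proof (cases "i \<in> U")
    case True
    then have "card (U - {i}) = n - 1" "n > 0"
      using Cons.prems(1,2) by (auto simp: card_gt_0_iff)
    moreover have "x S = y S" if "finite S" "card S + length js = n - 1" for S
      using \<open>n > 0\<close> that by (intro Cons.prems(3)) simp_all
    ultimately have "ext_mults N c js x (U - {i}) = ext_mults N c js y (U - {i})"
      using Cons.prems(1) by (intro Cons.IH[of _ "n - 1"]) simp_all
    then show ?thesis by (simp add: cre_def)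
  qed (simp add: cre_def)
  then show ?case by (simp add: ext_mult_def lincomb_eq_pairing)
qed simp

section \<open>Identification of the Kitt ideal with the top coefficients of the generated
  algebra\<close>

text \<open>The function f extends the list to all indices with values in the carrier. Summing over
  all generators adds nothing, because contraction by an index in T vanishes at T.\<close>

lemma koszul_diff_eq:
  assumes fs: "set fs \<subseteq> carrier R" and x: "x \<in> fns"
    and f: "f \<in> fns" "\<And>i. i < length fs \<Longrightarrow> f i = fs ! i"
  shows "koszul_diff R fs x T = kdiff {..<length fs} f x T"
proof -
  have "koszul_diff R fs x T = (\<Oplus>i\<in>{..<length fs}. f i \<otimes> ann i x T)"
    unfolding koszul_diff_def
  proof (rule add.finprod_mono_neutral_cong_left)
    show "ext_sgn R (card {j \<in> T. j < i}) \<otimes> fs ! i \<otimes> x (insert i T) = f i \<otimes> ann i x T"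
      if "i \<in> {..<length fs} - T" for i
    proof -
      have "fs ! i \<in> carrier R" using that fs by auto
      then show ?thesis using that f(2) x by (simp add: ann_def below_def m_ac)
    qed
  qed (use f(1) x in \<open>auto simp: ann_def\<close>)
  then show ?thesis by (simp add: kdiff_def lincomb_def)
qed

lemma koszul_cycles_eq:
  assumes fs: "set fs \<subseteq> carrier R" and f: "f \<in> fns" "\<And>i. i < length fs \<Longrightarrow> f i = fs ! i"
  shows "koszul_cycles R fs k = {z \<in> cycles {..<length fs} f. \<forall>S. card S \<noteq> k \<longrightarrow> z S = \<zero>}"
  using koszul_diff_eq[OF fs _ f]
  by (auto simp: koszul_cycles_def cycles_def ext_homog_def ext_alg_def fun_eq_iff)

lemma homogeneous_part_cycle:
  assumes N: "finite N" and f: "f \<in> fns" and z: "z \<in> cycles N f"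
  shows "(\<lambda>S. if card S = k then z S else \<zero>) \<in> cycles N f" (is "?z \<in> _")
proof -
  note zD = cyclesD[OF z] ext_algD[OF cyclesD(1)[OF z]]
  have "kdiff N f ?z T = \<zero>" for T
  \<comment> \<open>The differential lowers the degree by one. Infinite sets have
    \<open>card\<close> zero, so finiteness is tested separately; there the coefficients vanish by
    support.\<close>
  proof (cases "finite T \<and> Suc (card T) = k")
    case True
    then have "ann i ?z T = ann i z T" for i by (simp add: ann_def)
    then have "kdiff N f ?z T = kdiff N f z T" by (simp add: kdiff_def lincomb_eq_pairing)
    then show ?thesis using zD(3) by simp
  next
    case False
    have "ann i ?z T = \<zero>" for i
    proof (cases "finite T")
      case True
      then show ?thesis using False by (simp add: ann_def)
    next
      case inf: False
      then have "\<not> insert i T \<subseteq> N" using N finite_subset by auto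
      then show ?thesis using zD by (simp add: ann_def)
    qed
    then show ?thesis using f by (simp add: kdiff_def lincomb_eq_pairing pairing_zero)
  qed
  moreover have "?z \<in> ext_alg N" using zD by (simp add: ext_alg_def)
  ultimately show ?thesis by (simp add: cycles_def fun_eq_iff)
qed

text \<open>Each product of some \<gamma> and a cycle lies in the algebra generated by the cycles
  and the columns of c. Conversely, only homogeneous parts of cycles contribute to the top
  coefficient of such an algebra element.\<close>

lemma kitt_gens_eq:
  assumes fs: "set fs \<subseteq> carrier R" and c: "\<And>i j. c i j \<in> carrier R"
    and f: "f \<in> fns" "\<And>i. i < length fs \<Longrightarrow> f i = fs ! i"
    and \<aa>: "\<aa> = genideal R {finsum R (\<lambda>i. c i j \<otimes> fs ! i) {..<length fs} | j. j < s}"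
  shows "kitt_gens R fs c s = kitt_top {..<length fs} f \<aa>"
proof -
  let ?r = "length fs" let ?N = "{..<?r}"
  define V where "V = (\<lambda>j i. c i j) ` {..<s}"
  have V: "V \<subseteq> fns" using c by (auto simp: V_def)
  have "finsum R (\<lambda>i. c i j \<otimes> fs ! i) ?N = pairing ?N (\<lambda>i. c i j) f" for j
    unfolding pairing_def using f c by (intro finsum_cong') auto
  then have "{finsum R (\<lambda>i. c i j \<otimes> fs ! i) ?N | j. j < s} = (\<lambda>v. pairing ?N v f) ` V"
    by (auto simp: V_def)
  then have alg: "koszul_alg ?N f (lifts ?N f \<aa>) = koszul_alg ?N f V"
    unfolding \<aa> using koszul_alg_lifts[OF _ f(1) V, of ?N] by simp
  let ?A = "koszul_alg ?N f V"
  let ?G = "{ext_wedge R ?r \<gamma> z ?N | \<gamma> z j.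
        j \<le> ?r \<and> \<gamma> \<in> kgamma R ?r c s j \<and> z \<in> koszul_cycles R fs (?r - j)}"
  have monoA: "ext_mults ?N c js x \<in> ?A" if "set js \<subseteq> {..<s}" "x \<in> ?A" for js x
    using that by (induction js) (auto simp: V_def intro!: koszul_alg.mult)
  have mono_fns: "zeta_monomial R ?r c js \<in> fns" for js
    unfolding zeta_monomial_eq[OF c] by (rule linopD(1)[OF linop_ext_mults[OF c]]) (simp add: ext_one_def)
  have kgamma: "\<gamma> \<in> fns \<and> (\<forall>z\<in>cycles ?N f. ext_wedge R ?r \<gamma> z \<in> ?A)" if "\<gamma> \<in> kgamma R ?r c s k" for \<gamma> k
    using that
  proof induction
    case zero
    have "ext_wedge R ?r fzero z \<in> ?A" if "z \<in> cycles ?N f" for z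
      using linop_zero[OF linop_ext_wedge[OF cyclesD(2)[OF that]]]
        koszul_alg.cycle[OF fzero_cycle[OF f(1)]] by metis
    then show ?case by (simp add: fzero_def)
  next
    case (mono a js)
    have "ext_wedge R ?r (fsmult a (zeta_monomial R ?r c js)) z \<in> ?A" if z: "z \<in> cycles ?N f" for z
    proof -
      have "ext_wedge R ?r (fsmult a (zeta_monomial R ?r c js)) z = fsmult a (ext_mults ?N c js z)"
        unfolding linopD(3)[OF linop_ext_wedge[OF cyclesD(2)[OF z]] mono_fns mono(1)]
          ext_wedge_zeta_monomial[OF c cyclesD(1)[OF z]] ..
      then show ?thesis
        using koszul_alg_fsmult[OF V f(1) mono(1) monoA[OF mono(3) koszul_alg.cycle[OF z]]] by metis
    qed
    then show ?case using mono(1) mono_fns[of js] by (simp add: fsmult_def)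
  next
    case (add x y)
    have "ext_wedge R ?r (fadd x y) z \<in> ?A" if z: "z \<in> cycles ?N f" for z
    proof -
      have "ext_wedge R ?r (fadd x y) z = fadd (ext_wedge R ?r x z) (ext_wedge R ?r y z)"
        using linopD(2)[OF linop_ext_wedge[OF cyclesD(2)[OF z]]] add by metis
      then show ?thesis
        using add z koszul_alg.add by metis
    qed
    then show ?case using add by (simp add: fadd_def)
  qed
  have G_sub: "?G \<subseteq> kitt_top ?N f \<aa>"
    using kgamma koszul_cycles_eq[OF fs f] unfolding kitt_top_def alg by blast
  have "kitt_gens R fs c s \<subseteq> kitt_top ?N f \<aa>"
    unfolding kitt_gens_def by (rule genideal_minimal[OF ideal_kitt_top[OF f(1)] G_sub])
  moreover have "kitt_top ?N f \<aa> \<subseteq> kitt_gens R fs c s"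
  proof -
    have G: "?G \<subseteq> carrier R"
      using G_sub ideal.Icarr[OF ideal_kitt_top[OF f(1)]] by blast
    interpret J: ideal "kitt_gens R fs c s" R
      unfolding kitt_gens_def by (rule genideal_ideal[OF G])
    \<comment> \<open>Quantifying over a monomial in front carries the induction: a further factor
      is absorbed by appending its index to \<open>js\<close>, and the empty list gives the
      claim.\<close>
    have "\<forall>js. set js \<subseteq> {..<s} \<longrightarrow> ext_mults ?N c js x ?N \<in> kitt_gens R fs c s" if "x \<in> ?A" for x
      using that
    proof induction
      case (cycle z)
      show ?case
      proof (intro allI impI)
        fix js assume js: "set js \<subseteq> {..<s}"
        note zf = cyclesD(2)[OF cycle]
        show "ext_mults ?N c js z ?N \<in> kitt_gens R fs c s"
        proof (cases "length js \<le> ?r")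
          case True
          \<comment> \<open>The only component that \<open>length js\<close> factors can raise to
            the top degree.\<close>
          let ?z = "\<lambda>S. if card S = ?r - length js then z S else \<zero>"
          have zc: "?z \<in> cycles ?N f" using f cycle by (intro homogeneous_part_cycle) auto
          then have "?z \<in> koszul_cycles R fs (?r - length js)"
            using koszul_cycles_eq[OF fs f] by simp
          moreover have "zeta_monomial R ?r c js \<in> kgamma R ?r c s (length js)"
            using kgamma.mono[of \<one> R js "length js" s ?r c] js mono_fns[of js] by simp
          ultimately have "ext_wedge R ?r (zeta_monomial R ?r c js) ?z ?N \<in> ?G"
            using True by blast
          then have "ext_mults ?N c js ?z ?N \<in> kitt_gens R fs c s"
            using genideal_self[OF G] ext_wedge_zeta_monomial[OF c cyclesD(1)[OF zc]]
            unfolding kitt_gens_def by auto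
          moreover have "ext_mults ?N c js z ?N = ext_mults ?N c js ?z ?N"
            using zf zc by (intro ext_mults_cong_card[where n = ?r] c) auto
          ultimately show ?thesis by simp
        next
          case False
          then have "ext_mults ?N c js z ?N = ext_mults ?N c js fzero ?N"
            using zf by (intro ext_mults_cong_card[where n = ?r] c) auto
          then show ?thesis
            using linop_zero[OF linop_ext_mults[OF c]] by simp
        qed
      qed
    next
      case (add x y)
      show ?case
      proof (intro allI impI)
        fix js assume js: "set js \<subseteq> {..<s}"
        have "ext_mults ?N c js (fadd x y) = fadd (ext_mults ?N c js x) (ext_mults ?N c js y)"
          using add koszul_alg_fns[OF V] by (intro linopD(2)[OF linop_ext_mults[OF c]]) blast+
        then show "ext_mults ?N c js (fadd x y) ?N \<in> kitt_gens R fs c s"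
          using add js by (simp add: J.a_closed)
      qed
    next
      case (mult v x)
      then obtain j where j: "j < s" "v = (\<lambda>i. c i j)" unfolding V_def by blast
      show ?case
      proof (intro allI impI)
        fix js assume js: "set js \<subseteq> {..<s}"
        have "ext_mults ?N c (js @ [j]) x ?N \<in> kitt_gens R fs c s"
          by (rule mult.IH[THEN spec, THEN mp]) (use js j in simp)
        then show "ext_mults ?N c js (ext_mult ?N v x) ?N \<in> kitt_gens R fs c s"
          using j by simp
      qed
    qed
    from this[THEN spec[of _ "[]"]] show ?thesis
      unfolding kitt_top_def alg by auto
  qed
  ultimately show ?thesis by blast
qed

text \<open>The choice is determined only if admissible data exist and all give the same value. The
  first needs finite generation and the inclusion of \<open>\<aa>\<close> in I; the second is
  independence of matrix and generators.\<close>

lemma Kitt_eq_kitt_top: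
  assumes \<aa>: "fin_gen_ideal R \<aa>" and sub: "\<aa> \<subseteq> I"
    and N: "finite N" and f: "f \<in> fns" and I: "genideal R (f ` N) = I"
  shows "Kitt R \<aa> I = kitt_top N f \<aa>"
proof -
  let ?P = "\<lambda>K. \<exists>fs c s. set fs \<subseteq> carrier R \<and> genideal R (set fs) = I \<and>
      (\<forall>i j. c i j \<in> carrier R) \<and>
      genideal R {finsum R (\<lambda>i. c i j \<otimes> fs ! i) {..<length fs} | j. j < s} = \<aa> \<and>
      K = kitt_gens R fs c s"
  have \<aa>_ideal: "ideal \<aa> R" using \<aa> by (simp add: fin_gen_ideal_def)
  let ?ext = "\<lambda>fs i. if i < length fs then fs ! i else \<zero>"
  have ext: "?ext fs \<in> fns" "?ext fs ` {..<length fs} = set fs" if "set fs \<subseteq> carrier R" for fs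
    using that nth_mem by (auto simp: in_set_conv_nth subset_iff)
  have unique: "K = kitt_top N f \<aa>" if "?P K" for K
  proof -
    obtain fs c s where fs: "set fs \<subseteq> carrier R" "genideal R (set fs) = I"
      and "\<forall>i j. c i j \<in> carrier R"
      and eq: "genideal R {finsum R (\<lambda>i. c i j \<otimes> fs ! i) {..<length fs} | j. j < s} = \<aa>"
      and K: "K = kitt_gens R fs c s"
      using \<open>?P K\<close> by blast
    then have c: "c i j \<in> carrier R" for i j by simp
    have "K = kitt_top {..<length fs} (?ext fs) \<aa>"
      unfolding K using fs c ext[OF fs(1)] eq[symmetric] by (intro kitt_gens_eq) simp_all
    also have "\<dots> = kitt_top N f \<aa>"
      using ext[OF fs(1)] N f \<aa>_ideal I fs(2) by (intro kitt_top_eq) simp_all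
    finally show ?thesis .
  qed
  have "finite (f ` N)" using N by simp
  from finite_list[OF this] obtain fs where fs: "set fs = f ` N" by blast
  have fsc: "set fs \<subseteq> carrier R" using fs f by auto
  obtain T where T: "finite T" "T \<subseteq> carrier R" "\<aa> = genideal R T"
    using \<aa> by (auto simp: fin_gen_ideal_def)
  obtain as where as: "set as = T" using finite_list[OF T(1)] by blast
  have "\<exists>v\<in>fns. pairing {..<length fs} v (?ext fs) = as ! j" if "j < length as" for j
  proof -
    have "as ! j \<in> T" using nth_mem[OF that] as by simp
    then have "as ! j \<in> I" using T(3) genideal_self[OF T(2)] sub by blast
    also have "I = {pairing {..<length fs} v (?ext fs) | v. v \<in> fns}"
      using genideal_pairing[OF _ ext(1)[OF fsc], of "{..<length fs}"] ext(2)[OF fsc] fs I by simp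
    finally show ?thesis by auto
  qed
  then obtain w where w: "\<And>j. j < length as \<Longrightarrow> w j \<in> fns"
      "\<And>j. j < length as \<Longrightarrow> pairing {..<length fs} (w j) (?ext fs) = as ! j" by metis
  \<comment> \<open>Column j holds coordinates of the j-th generator of \<open>\<aa>\<close>; the
    remaining columns are zero because all entries must lie in the carrier.\<close>
  define c where "c i j = (if j < length as then w j i else \<zero>)" for i j
  have c: "c i j \<in> carrier R" for i j using w(1)[of j] by (simp add: c_def)
  have "finsum R (\<lambda>i. c i j \<otimes> fs ! i) {..<length fs} = as ! j" if j: "j < length as" for j
  proof -
    have "finsum R (\<lambda>i. c i j \<otimes> fs ! i) {..<length fs} = pairing {..<length fs} (w j) (?ext fs)"
      unfolding pairing_def using j w(1)[OF j] ext(1)[OF fsc] by (intro finsum_cong') (auto simp: c_def)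
    then show ?thesis using w(2)[OF j] by simp
  qed
  then have "{finsum R (\<lambda>i. c i j \<otimes> fs ! i) {..<length fs} | j. j < length as} = {as ! j | j. j < length as}"
    by (metis (no_types, lifting))
  also have "\<dots> = T" using as by (auto simp: set_conv_nth)
  finally have "genideal R {finsum R (\<lambda>i. c i j \<otimes> fs ! i) {..<length fs} | j. j < length as} = \<aa>"
    using T(3) by simp
  then have "?P (kitt_gens R fs c (length as))"
    using fsc fs I c by (intro exI[of _ fs] exI[of _ c] exI[of _ "length as"] conjI) simp_all
  then have "?P (Kitt R \<aa> I)"
    unfolding Kitt_def by (rule someI)
  then show ?thesis by (rule unique)
qed

end

subsection \<open>Passage to the quotient\<close>

context ring_hom_cring
begin

lemma hom_pairing:
  "v \<in> R.fns \<Longrightarrow> f \<in> R.fns \<Longrightarrow> h (R.pairing N v f) = S.pairing N (\<lambda>i. h (v i)) (\<lambda>i. h (f i))"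
  unfolding R.pairing_def S.pairing_def by (subst hom_finsum) (auto intro!: S.finsum_cong')

lemma hom_ext_sgn [simp]: "h (ext_sgn R n) = ext_sgn S n"
  by (simp add: ext_sgn_def)

lemma hom_cre: "x \<in> R.fns \<Longrightarrow> h (R.cre i x T) = S.cre i (\<lambda>T. h (x T)) T"
  and hom_ann: "x \<in> R.fns \<Longrightarrow> h (R.ann i x T) = S.ann i (\<lambda>T. h (x T)) T"
  by (simp_all add: R.cre_def S.cre_def R.ann_def S.ann_def)

lemma hom_ext_mult:
  assumes "v \<in> R.fns" "x \<in> R.fns"
  shows "h (R.ext_mult N v x T) = S.ext_mult N (\<lambda>i. h (v i)) (\<lambda>T. h (x T)) T"
  using assms hom_pairing[of v "\<lambda>i. R.cre i x T" N]
  by (simp add: R.ext_mult_def S.ext_mult_def R.lincomb_eq_pairing S.lincomb_eq_pairing hom_cre)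

lemma hom_kdiff:
  assumes "f \<in> R.fns" "x \<in> R.fns"
  shows "h (R.kdiff N f x T) = S.kdiff N (\<lambda>i. h (f i)) (\<lambda>T. h (x T)) T"
  using assms hom_pairing[of f "\<lambda>i. R.ann i x T" N]
  by (simp add: R.kdiff_def S.kdiff_def R.lincomb_eq_pairing S.lincomb_eq_pairing hom_ann)

lemma ideal_image:
  assumes surj: "h ` carrier R = carrier S" and I: "ideal I R"
  shows "ideal (h ` I) S"
proof -
  interpret I: ideal I R by fact
  show ?thesis
  proof (rule S.idealI_cring)
    show "h ` I \<subseteq> carrier S" using I.Icarr by auto
    show "\<zero>\<^bsub>S\<^esub> \<in> h ` I" using I.zero_closed hom_zero by (metis image_eqI)
    show "a \<oplus>\<^bsub>S\<^esub> b \<in> h ` I" if ab: "a \<in> h ` I" "b \<in> h ` I" for a b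
    proof -
      obtain x y where "x \<in> I" "a = h x" "y \<in> I" "b = h y" using ab by blast
      then have "a \<oplus>\<^bsub>S\<^esub> b = h (x \<oplus> y)" "x \<oplus> y \<in> I" using I.Icarr by auto
      then show ?thesis by blast
    qed
    show "a \<otimes>\<^bsub>S\<^esub> b \<in> h ` I" if ab: "a \<in> carrier S" "b \<in> h ` I" for a b
    proof -
      obtain x y where "x \<in> carrier R" "a = h x" "y \<in> I" "b = h y" using ab surj by blast
      then have "a \<otimes>\<^bsub>S\<^esub> b = h (x \<otimes> y)" "x \<otimes> y \<in> I" using I.Icarr I.I_l_closed by auto
      then show ?thesis by blast
    qed
  qed
qed

text \<open>One inclusion holds because the preimage of an ideal is an ideal; the other because
  surjectivity makes the image of an ideal an ideal.\<close>

lemma image_genideal: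
  assumes surj: "h ` carrier R = carrier S" and T: "T \<subseteq> carrier R"
  shows "h ` genideal R T = genideal S (h ` T)"
proof
  have hT: "h ` T \<subseteq> carrier S" using T by auto
  interpret J: ideal "genideal S (h ` T)" S by (rule S.genideal_ideal[OF hT])
  let ?P = "{a \<in> carrier R. h a \<in> genideal S (h ` T)}"
  have "ideal ?P R"
    by (rule R.idealI_cring) (auto intro: J.I_l_closed J.a_closed)
  moreover have "T \<subseteq> ?P" using T S.genideal_self[OF hT] by auto
  ultimately have "genideal R T \<subseteq> ?P" by (rule R.genideal_minimal)
  then show "h ` genideal R T \<subseteq> genideal S (h ` T)" by blast
  show "genideal S (h ` T) \<subseteq> h ` genideal R T"
    using R.genideal_self[OF T] by (intro S.genideal_minimal ideal_image surj R.genideal_ideal T) auto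
qed

lemma fin_gen_ideal_image:
  assumes surj: "h ` carrier R = carrier S" and I: "fin_gen_ideal R I"
  shows "fin_gen_ideal S (h ` I)"
proof -
  obtain T where T: "finite T" "T \<subseteq> carrier R" "I = genideal R T"
    using I unfolding fin_gen_ideal_def by blast
  then have "finite (h ` T)" "h ` T \<subseteq> carrier S" "h ` I = genideal S (h ` T)"
    using image_genideal[OF surj T(2)] by auto
  moreover have "ideal (h ` I) S"
    using I by (intro ideal_image surj) (simp add: fin_gen_ideal_def)
  ultimately show ?thesis unfolding fin_gen_ideal_def by blast
qed

text \<open>Write cycles over \<open>R\<close> as \<open>z = x + e\<^sub>m y\<close>,
  where \<open>x\<close> and \<open>y\<close> do not involve \<open>e\<^sub>m\<close>. Then \<open>\<partial>z = 0\<close> says \<open>\<partial>x = - f\<^sub>m y\<close> and \<open>\<partial>y = 0\<close>, and by regularity the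
  second equation follows from the first. So \<open>z \<mapsto> x\<close> maps the cycles over \<open>R\<close> onto the cycles over
  the quotient by \<open>f\<^sub>m\<close>, and the top coefficients correspond since \<open>e\<^sub>m\<close> lifts \<open>f\<^sub>m \<in> \<aa>\<close>.\<close>

lemma image_kitt_top:
  assumes surj: "h ` carrier R = carrier S"
    and ker: "\<And>a. a \<in> carrier R \<Longrightarrow> h a = \<zero>\<^bsub>S\<^esub> \<longleftrightarrow> (\<exists>b\<in>carrier R. a = f m \<otimes> b)"
    and N: "finite N" and m: "m \<notin> N" and f: "f \<in> R.fns"
    and reg: "\<And>y. y \<in> carrier R \<Longrightarrow> f m \<otimes> y = \<zero> \<Longrightarrow> y = \<zero>"
    and \<aa>: "ideal \<aa> R" and fm: "f m \<in> \<aa>"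
  shows "h ` R.kitt_top (insert m N) f \<aa> = S.kitt_top N (\<lambda>i. h (f i)) (h ` \<aa>)"
proof -
  interpret \<aa>: ideal \<aa> R by fact
  let ?N = "insert m N" let ?f = "\<lambda>i. h (f i)"
  let ?W = "R.lifts ?N f \<aa>" let ?W' = "S.lifts N ?f (h ` \<aa>)"
  let ?A = "R.koszul_alg ?N f ?W" let ?A' = "S.koszul_alg N ?f ?W'"
  have N': "finite ?N" using N by simp
  have hf: "?f \<in> S.fns" using f by simp
  have h_fm: "h (f m) = \<zero>\<^bsub>S\<^esub>"
    using f by (subst ker) (auto intro!: bexI[of _ \<one>])
  note fns = R.koszul_alg_fns[OF R.lifts_subset[of ?N f \<aa>]]
  note sub = R.koszul_alg_subset[OF R.lifts_subset[of ?N f \<aa>]]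
  note fns' = S.koszul_alg_fns[OF S.lifts_subset[of N ?f "h ` \<aa>"]]
  \<comment> \<open>In z = x + e_m y, \<open>res z\<close> is x and \<open>ann m z\<close> is
    y.\<close>
  define res where "res x = (\<lambda>T. if m \<in> T then \<zero> else x T)" for x :: "nat set \<Rightarrow> 'a"
  have res_fns: "res x \<in> R.fns" if "x \<in> R.fns" for x using that by (simp add: res_def)
  have res_alg: "res x \<in> R.ext_alg N" if "x \<in> R.ext_alg ?N" for x
    using that by (auto simp: res_def R.ext_alg_def subset_insert)
  have mult_res: "R.ext_mult ?N v x T = R.ext_mult N v (res x) T"
    if "v \<in> R.fns" "x \<in> R.fns" "m \<notin> T" for v x T
  proof -
    have "R.ext_mult ?N v x T = R.ext_mult N v x T"
      using R.ext_mult_insert[OF N m that(1,2)] that by (simp add: R.cre_def)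
    moreover have "R.cre i x T = R.cre i (res x) T" for i
      using that(3) by (simp add: R.cre_def res_def)
    ultimately show ?thesis by (simp add: R.ext_mult_def R.lincomb_eq_pairing)
  qed
  have mult_zero: "R.ext_mult N v x T = \<zero>"
    if "v \<in> R.fns" and "\<And>T. m \<in> T \<Longrightarrow> x T = \<zero>" and "m \<in> T" for v x T
  proof -
    have "R.cre i x T = \<zero>" if "i \<in> N" for i
    proof -
      have "m \<in> T - {i}" using m \<open>i \<in> N\<close> \<open>m \<in> T\<close> by auto
      then have "x (T - {i}) = \<zero>" by (rule \<open>\<And>T. m \<in> T \<Longrightarrow> x T = \<zero>\<close>)
      then show ?thesis by (simp add: R.cre_def)
    qed
    then show ?thesis
      using that(1) by (simp add: R.ext_mult_def R.lincomb_eq_pairing R.pairing_zero)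
  qed
  have res_mult: "res (R.ext_mult ?N v x) = R.ext_mult N v (res x)"
    if "v \<in> R.fns" "x \<in> R.fns" for v x
    using mult_res[OF that] mult_zero[OF that(1), of "res x"] by (auto simp: res_def fun_eq_iff)
  have ann_mult: "R.ann m (R.ext_mult ?N v x) T = v m \<otimes> res x T \<oplus> \<ominus> R.ext_mult N v (R.ann m x) T"
    if v: "v \<in> R.fns" and x: "x \<in> R.fns" for v x T
  proof (cases "m \<in> T")
    case True
    moreover have "R.ext_mult N v (R.ann m x) T = \<zero>"
      using True by (intro mult_zero v) (auto simp: R.ann_def)
    ultimately show ?thesis using v by (simp add: R.ann_def res_def)
  next
    case False
    have "res (R.ann m x) = R.ann m x" by (auto simp: res_def R.ann_def)
    moreover have "R.ann m x \<in> R.fns" using x by simp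
    ultimately have "R.ext_mult ?N v (R.ann m x) T = R.ext_mult N v (R.ann m x) T"
      using mult_res[OF v _ False] by metis
    then show ?thesis
      using R.ann_ext_mult[OF N' v x, of m] False by (simp add: res_def)
  qed
  \<comment> \<open>The kernel is generated by f_m and lies in \<open>\<aa>\<close>, so membership
    in \<open>\<aa>\<close> can be tested in the quotient.\<close>
  have lift_ideal: "a \<in> \<aa>" if "a \<in> carrier R" "h a \<in> h ` \<aa>" for a
  proof -
    obtain b where b: "b \<in> \<aa>" "h a = h b" using \<open>h a \<in> h ` \<aa>\<close> by blast
    then have "h (a \<ominus> b) = \<zero>\<^bsub>S\<^esub>"
      using that \<aa>.Icarr by (simp add: R.minus_eq S.r_neg)
    then obtain k where k: "k \<in> carrier R" "a \<ominus> b = f m \<otimes> k"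
      using ker[of "a \<ominus> b"] \<open>a \<in> carrier R\<close> \<aa>.Icarr[OF b(1)] by auto
    have "a = f m \<otimes> k \<oplus> b"
      using k(2)[symmetric] that \<aa>.Icarr[OF b(1)] by (simp add: R.minus_eq R.a_assoc R.l_neg)
    then show ?thesis using k b fm by (simp add: \<aa>.I_r_closed \<aa>.a_closed)
  qed
  \<comment> \<open>The goal concerns y alone, but x is carried along because the e_m-part of a
    product with v contains v_m x.\<close>
  have forward: "(\<lambda>T. h (res x T)) \<in> ?A' \<and> (\<lambda>T. h (R.ann m x T)) \<in> ?A'" if "x \<in> ?A" for x
    using that
  proof induction
    case (cycle z)
    note zD = R.cyclesD[OF cycle]
    let ?y = "R.ann m z"
    have y: "?y \<in> R.fns" using zD by simp
    have eq: "f m \<otimes> ?y T \<oplus> R.kdiff N f z T = \<zero>" for T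
      using zD(3) R.kdiff_insert[OF N m f zD(2)] by (simp add: fun_eq_iff)
    have dy: "R.kdiff N f ?y T = \<zero>" for T
    proof (cases "m \<in> T")
      case True
      have "R.ann i ?y T = \<zero>" for i using True zD(2) by (simp add: R.ann_def)
      then show ?thesis using f by (simp add: R.kdiff_def R.lincomb_eq_pairing R.pairing_zero)
    next
      case False
      have com: "R.ann m (R.lincomb R.ann N f z) =
          R.fadd (R.fsmult (R.pairing N f R.fzero) z) (R.fneg (R.lincomb R.ann N f ?y))"
        using f zD(2) N
        by (intro R.lincomb_anticommute[where k = R.fzero])
           (auto simp: R.ann_ann[of _ m] fun_eq_iff)
      \<comment> \<open>At sets containing m the e_m-part drops out of \<open>eq\<close>, so the
        differential over N of z vanishes there; contracting by e_m turns this into dy = 0.\<close>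
      have "f m \<otimes> ?y (insert m T) \<oplus> R.kdiff N f z (insert m T) = \<zero>" by (rule eq)
      then have "R.kdiff N f z (insert m T) = \<zero>" using f zD(2) by (simp add: R.ann_def)
      then have "R.ann m (R.kdiff N f z) T = \<zero>" by (simp add: R.ann_def)
      then have "\<ominus> R.kdiff N f ?y T = \<zero>"
        using com f zD(2) by (simp add: R.kdiff_def R.pairing_zero)
      then have "\<ominus> (\<ominus> R.kdiff N f ?y T) = \<ominus> \<zero>" by simp
      then show ?thesis using R.kdiff_closed[OF f y] by (simp only: R.minus_minus R.minus_zero)
    qed
    have "?y \<in> R.ext_alg N"
      using R.ext_alg_ann[OF zD(1)] R.ann_ann_self[OF zD(2)] by (rule R.ext_alg_insertD)
    then have 1: "(\<lambda>T. h (?y T)) \<in> S.cycles N ?f"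
      using hom_kdiff[OF f y, of N] dy
      by (simp add: S.cycles_def S.ext_alg_def R.ext_alg_def fun_eq_iff)
    have "h (R.kdiff N f (res z) T) = \<zero>\<^bsub>S\<^esub>" for T
    proof (cases "m \<in> T")
      case True
      have "R.ann i (res z) T = \<zero>" for i using True by (simp add: R.ann_def res_def)
      then show ?thesis using f by (simp add: R.kdiff_def R.lincomb_eq_pairing R.pairing_zero)
    next
      case False
      have "R.pairing N f (\<lambda>i. R.ann i (res z) T) = R.pairing N f (\<lambda>i. R.ann i z T)"
        using m False f zD(2) by (intro R.pairing_cong) (auto simp: R.ann_def res_def)
      then have "R.kdiff N f (res z) T = R.kdiff N f z T"
        by (simp add: R.kdiff_def R.lincomb_eq_pairing)
      moreover have "h (f m \<otimes> ?y T \<oplus> R.kdiff N f z T) = \<zero>\<^bsub>S\<^esub>" using eq by simp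
      ultimately show ?thesis using f zD(2) h_fm by simp
    qed
    then have 2: "(\<lambda>T. h (res z T)) \<in> S.cycles N ?f"
      using hom_kdiff[OF f res_fns[OF zD(2)], of N] res_alg[OF zD(1)]
      by (simp add: S.cycles_def S.ext_alg_def R.ext_alg_def fun_eq_iff)
    show ?case using 1 2 by (intro conjI S.koszul_alg.cycle)
  next
    case (add x y)
    have xy: "x \<in> R.fns" "y \<in> R.fns" using add fns by blast+
    have "(\<lambda>T. h (res (R.fadd x y) T)) = S.fadd (\<lambda>T. h (res x T)) (\<lambda>T. h (res y T))"
      using xy by (auto simp: res_def fun_eq_iff)
    moreover have "(\<lambda>T. h (R.ann m (R.fadd x y) T)) = S.fadd (\<lambda>T. h (R.ann m x T)) (\<lambda>T. h (R.ann m y T))"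
      using xy R.linopD(2)[OF R.linop_ann xy, of m] by (simp add: fun_eq_iff)
    ultimately show ?case using add S.koszul_alg.add by metis
  next
    case (mult v x)
    have v: "v \<in> R.fns" "R.pairing ?N v f \<in> \<aa>" using mult(1) by (simp_all add: R.lifts_def)
    have x: "x \<in> R.fns" using mult(2) fns by blast
    have "R.pairing N v f = R.pairing ?N v f \<oplus> \<ominus> (v m \<otimes> f m)"
      using R.pairing_insert[OF N m v(1) f] v(1) f
      by (simp add: R.a_ac R.r_neg R.r_neg2 R.l_neg)
    then have "R.pairing N v f \<in> \<aa>"
      using v fm by (simp add: \<aa>.a_closed \<aa>.a_inv_closed \<aa>.I_l_closed)
    then have hv: "(\<lambda>i. h (v i)) \<in> ?W'"
      using v f by (auto simp: S.lifts_def hom_pairing[symmetric])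
    have "(\<lambda>T. h (res (R.ext_mult ?N v x) T)) = S.ext_mult N (\<lambda>i. h (v i)) (\<lambda>T. h (res x T))"
      using hom_ext_mult[OF v(1) res_fns[OF x], of N] by (simp add: res_mult[OF v(1) x] fun_eq_iff)
    then have 1: "(\<lambda>T. h (res (R.ext_mult ?N v x) T)) \<in> ?A'"
      using S.koszul_alg.mult[OF hv] mult by metis
    have ax: "R.ann m x \<in> R.fns" using x by simp
    have "(\<lambda>T. h (R.ann m (R.ext_mult ?N v x) T)) =
        S.fadd (S.fsmult (h (v m)) (\<lambda>T. h (res x T)))
          (S.fneg (S.ext_mult N (\<lambda>i. h (v i)) (\<lambda>T. h (R.ann m x T))))"
    proof
      fix T
      show "h (R.ann m (R.ext_mult ?N v x) T) = S.fadd (S.fsmult (h (v m)) (\<lambda>T. h (res x T)))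
          (S.fneg (S.ext_mult N (\<lambda>i. h (v i)) (\<lambda>T. h (R.ann m x T)))) T"
        using v res_fns[OF x] R.ext_mult_closed[OF v(1) ax]
        by (simp add: ann_mult[OF v(1) x] hom_ext_mult[OF v(1) ax])
    qed
    moreover have "h (v m) \<in> carrier S" using v by simp
    moreover have "S.ext_mult N (\<lambda>i. h (v i)) (\<lambda>T. h (R.ann m x T)) \<in> ?A'"
      using S.koszul_alg.mult[OF hv] mult by metis
    ultimately have 2: "(\<lambda>T. h (R.ann m (R.ext_mult ?N v x) T)) \<in> ?A'"
      using mult S.koszul_alg.add S.koszul_alg_fsmult[OF S.lifts_subset hf]
        S.koszul_alg_fneg[OF S.lifts_subset hf] by metis
    show ?case using 1 2 by blast
  qed
  \<comment> \<open>Agreement is asked only at sets avoiding m, which leaves the e_m-part free to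
    correct a lifted boundary.\<close>
  have backward: "\<exists>x\<in>?A. \<forall>T. m \<notin> T \<longrightarrow> h (x T) = y T" if "y \<in> ?A'" for y
    using that
  proof induction
    case (cycle y)
    note yD = S.cyclesD[OF cycle]
    \<comment> \<open>Zero coefficients are lifted to zero, so that the lift is still supported on
      N.\<close>
    have "\<exists>a\<in>carrier R. h a = y T \<and> (y T = \<zero>\<^bsub>S\<^esub> \<longrightarrow> a = \<zero>)" for T
    proof (cases "y T = \<zero>\<^bsub>S\<^esub>")
      case True
      then show ?thesis using hom_zero R.zero_closed by metis
    next
      case False
      have "y T \<in> h ` carrier R" using yD(2) surj by simp
      then show ?thesis using False by auto
    qed
    then obtain x where x: "\<And>T. x T \<in> carrier R" "\<And>T. h (x T) = y T"
      "\<And>T. y T = \<zero>\<^bsub>S\<^esub> \<Longrightarrow> x T = \<zero>" by metis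
    have xf: "x \<in> R.fns" using x by simp
    have xE: "x \<in> R.ext_alg N" using x S.ext_algD(3)[OF yD(1)] by (simp add: R.ext_alg_def)
    have dxE: "R.kdiff N f x \<in> R.ext_alg N" by (rule R.ext_alg_kdiff[OF f xE])
    have "h (R.kdiff N f x T) = \<zero>\<^bsub>S\<^esub>" for T
      using hom_kdiff[OF f xf, of N T] yD(3) by (simp add: x)
    then have "\<exists>b\<in>carrier R. R.kdiff N f x T = f m \<otimes> b" for T
      using ker[of "R.kdiff N f x T"] R.kdiff_closed[OF f xf] by auto
    then obtain w where w: "\<And>T. w T \<in> carrier R" "\<And>T. R.kdiff N f x T = f m \<otimes> w T" by metis
    have wf: "w \<in> R.fns" using w by simp
    have fmc: "f m \<in> carrier R" using f by simp
    \<comment> \<open>The choice of w fixes only its product with f_m; cancellation also controls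
      its support.\<close>
    have wE: "w \<in> R.ext_alg N"
    proof -
      have "w T = \<zero>" if "\<not> T \<subseteq> N" for T
      proof (rule reg[OF w(1)])
        show "f m \<otimes> w T = \<zero>" using w(2)[of T] R.ext_algD(3)[OF dxE that] by metis
      qed
      then show ?thesis using wf by (simp add: R.ext_alg_def)
    qed
    have dw: "R.kdiff N f w = R.fzero"
    proof
      fix T
      have "R.kdiff N f x = R.fsmult (f m) w" using w by (simp add: fun_eq_iff)
      then have "R.fsmult (f m) (R.kdiff N f w) = R.kdiff N f (R.kdiff N f x)"
        using R.linopD(3)[OF R.linop_kdiff[OF f] wf fmc, of N] by metis
      then have "f m \<otimes> R.kdiff N f w T = \<zero>"
        using R.kdiff_kdiff[OF N f xf] by (simp add: fun_eq_iff)
      then show "R.kdiff N f w T = R.fzero T"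
        using reg R.kdiff_closed[OF f wf] by simp
    qed
    \<comment> \<open>The lift is x - e_m w. Its e_m-part contributes -f_m w, cancelling dx = f_m w,
      and the other generators contribute nothing because dw = 0.\<close>
    let ?w = "R.fneg w" let ?z = "R.fadd x (R.cre m ?w)"
    have w'f: "?w \<in> R.fns" using wf by simp
    have cf: "R.cre m ?w \<in> R.fns" using w'f by simp
    have zf: "?z \<in> R.fns" using xf cf by simp
    have creE: "R.cre m ?w \<in> R.ext_alg ?N"
      using wE by (simp add: R.ext_alg_def R.cre_def subset_insert_iff)
    have zE: "?z \<in> R.ext_alg ?N"
      using R.ext_alg_mono[of N ?N] xE creE by (intro R.ext_alg_fadd) auto
    have com: "R.cre m (R.lincomb R.ann N f ?w) =
        R.fadd (R.fsmult (R.pairing N f (\<lambda>i. if i = m then \<one> else \<zero>)) ?w)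
               (R.fneg (R.lincomb R.ann N f (R.cre m ?w)))"
      by (intro R.lincomb_anticommute R.linop_cre R.linop_ann R.cre_ann N f w'f) simp
    have "R.pairing N f (\<lambda>i. if i = m then \<one> else \<zero>) = \<zero>"
      using m f by (intro R.pairing_zero) auto
    moreover have "R.lincomb R.ann N f ?w = R.fzero"
      using R.linop_neg[OF R.linop_kdiff[OF f] wf, of N] dw by (simp add: R.kdiff_def fun_eq_iff)
    ultimately have "R.fzero = R.fadd (R.fsmult \<zero> ?w) (R.fneg (R.kdiff N f (R.cre m ?w)))"
      using com R.linop_zero[OF R.linop_cre[of m]] unfolding R.kdiff_def by metis
    then have "R.fzero T = R.fadd (R.fsmult \<zero> ?w) (R.fneg (R.kdiff N f (R.cre m ?w))) T" for T
      by (rule fun_cong)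
    then have "\<ominus> R.kdiff N f (R.cre m ?w) T = \<zero>" for T
      using w'f R.kdiff_closed[OF f cf] by simp
    then have "\<ominus> (\<ominus> R.kdiff N f (R.cre m ?w) T) = \<ominus> \<zero>" for T by simp
    then have dcre: "R.kdiff N f (R.cre m ?w) T = \<zero>" for T
      using R.kdiff_closed[OF f cf] by (simp only: R.minus_minus R.minus_zero)
    have "R.ann m ?z = R.fadd (R.ann m x) (R.ann m (R.cre m ?w))"
      using xf cf by (intro R.linopD(2) R.linop_ann)
    moreover have "R.ann m (R.cre m ?w) = ?w"
    proof -
      have "R.ann m ?w = R.fzero" by (rule R.ann_ext_alg[OF m R.ext_alg_fneg[OF wE]])
      then have "R.cre m (R.ann m ?w) = R.fzero" using R.linop_zero[OF R.linop_cre[of m]] by simp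
      then show ?thesis using R.ann_cre[OF w'f, of m m] w by (simp add: fun_eq_iff)
    qed
    ultimately have annz: "R.ann m ?z T = \<ominus> w T" for T
      using R.ann_ext_alg[OF m xE] w by simp
    have "R.kdiff N f ?z = R.fadd (R.kdiff N f x) (R.kdiff N f (R.cre m ?w))"
      using xf cf f by (intro R.linopD(2) R.linop_kdiff)
    then have "R.kdiff N f ?z T = f m \<otimes> w T" for T
      using dcre w fmc by simp
    then have "R.kdiff ?N f ?z = R.fzero"
      using R.kdiff_insert[OF N m f zf] annz w fmc
      by (simp add: fun_eq_iff R.r_minus R.l_neg)
    then have "?z \<in> R.cycles ?N f" using zE unfolding R.cycles_def by blast
    then have "?z \<in> ?A" by (rule R.koszul_alg.cycle)
    moreover have "h (?z T) = y T" if "m \<notin> T" for T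
      using that x by (simp add: R.cre_def)
    ultimately show ?case by blast
  next
    case (add y1 y2)
    then obtain x1 x2 where x: "x1 \<in> ?A" "x2 \<in> ?A"
      "\<forall>T. m \<notin> T \<longrightarrow> h (x1 T) = y1 T" "\<forall>T. m \<notin> T \<longrightarrow> h (x2 T) = y2 T" by blast
    have "x1 \<in> R.fns" "x2 \<in> R.fns" using x fns by blast+
    then have "\<forall>T. m \<notin> T \<longrightarrow> h (R.fadd x1 x2 T) = S.fadd y1 y2 T"
      using x by simp
    then show ?case using R.koszul_alg.add[OF x(1,2)] by blast
  next
    case (mult v y)
    then obtain x where x: "x \<in> ?A" "\<forall>T. m \<notin> T \<longrightarrow> h (x T) = y T" by blast
    have xf: "x \<in> R.fns" using x fns by blast
    have v: "v \<in> S.fns" "S.pairing N v ?f \<in> h ` \<aa>" using mult(1) by (simp_all add: S.lifts_def)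
    have "\<exists>a\<in>carrier R. h a = v i" for i
    proof -
      have "v i \<in> h ` carrier R" using v surj by simp
      then show ?thesis by auto
    qed
    then obtain u0 where u0: "\<And>i. u0 i \<in> carrier R" "\<And>i. h (u0 i) = v i" by metis
    \<comment> \<open>With no coordinate at m, the boundaries over both index sets coincide, so
      \<open>lift_ideal\<close> applies.\<close>
    let ?u = "u0(m := \<zero>)"
    have u: "?u \<in> R.fns" "?u m = \<zero>" using u0 by simp_all
    have hu: "S.pairing N (\<lambda>i. h (?u i)) ?f = S.pairing N v ?f"
      using m u0 v hf by (intro S.pairing_cong) auto
    then have "R.pairing N ?u f \<in> \<aa>"
      using v u f by (intro lift_ideal) (simp_all add: hom_pairing)
    then have "?u \<in> ?W"
      using R.pairing_insert[OF N m u(1) f] u f by (simp add: R.lifts_def)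
    then have "R.ext_mult ?N ?u x \<in> ?A" using x(1) by (rule R.koszul_alg.mult)
    moreover have "h (R.ext_mult ?N ?u x T) = S.ext_mult N v y T" if T: "m \<notin> T" for T
    proof -
      have yf: "y \<in> S.fns" using mult fns' by blast
      have "h (R.ext_mult ?N ?u x T) = S.pairing N (\<lambda>i. h (?u i)) (\<lambda>i. S.cre i (\<lambda>T. h (res x T)) T)"
        using hom_ext_mult[OF u(1) res_fns[OF xf], of N T]
        unfolding mult_res[OF u(1) xf T] by (simp only: S.ext_mult_def S.lincomb_eq_pairing)
      also have "\<dots> = S.pairing N v (\<lambda>i. S.cre i y T)"
        using m u0 v T x(2) yf by (intro S.pairing_cong) (auto simp: S.cre_def res_def)
      finally show ?thesis by (simp add: S.ext_mult_def S.lincomb_eq_pairing)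
    qed
    ultimately show ?case by blast
  qed
  interpret T: ideal "R.kitt_top ?N f \<aa>" R by (rule R.ideal_kitt_top[OF f])
  interpret T': ideal "S.kitt_top N ?f (h ` \<aa>)" S by (rule S.ideal_kitt_top[OF hf])
  show ?thesis
  proof (intro equalityI subsetI)
    fix b assume "b \<in> h ` R.kitt_top ?N f \<aa>"
    then obtain x where x: "x \<in> ?A" "b = h (x ?N)" unfolding R.kitt_top_def by blast
    have xf: "x \<in> R.fns" using x fns by blast
    have "x ?N = ext_sgn R (below m N) \<otimes> R.ann m x N"
      using m xf by (simp add: R.ann_def)
    then have "b = ext_sgn S (below m N) \<otimes>\<^bsub>S\<^esub> h (R.ann m x N)"
      using x(2) xf by simp
    moreover have "h (R.ann m x N) \<in> S.kitt_top N ?f (h ` \<aa>)"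
      unfolding S.kitt_top_def by (rule image_eqI[OF _ conjunct2[OF forward[OF x(1)]]]) simp
    ultimately show "b \<in> S.kitt_top N ?f (h ` \<aa>)" using T'.I_l_closed by simp
  next
    fix b assume "b \<in> S.kitt_top N ?f (h ` \<aa>)"
    then obtain y where y: "y \<in> ?A'" "b = y N" unfolding S.kitt_top_def by blast
    then obtain x where x: "x \<in> ?A" "h (x N) = b" using backward m by metis
    have xf: "x \<in> R.fns" using x fns by blast
    \<comment> \<open>The generator e_m itself: its boundary f_m lies in \<open>\<aa>\<close>, and
      multiplying by it carries the coefficient at N to the top one.\<close>
    let ?d = "\<lambda>i. if i = m then \<one> else \<zero>"
    have d: "?d \<in> R.fns" by simp
    have "R.pairing N ?d f = \<zero>"
      using m f by (subst R.pairing_comm) (auto intro!: R.pairing_zero)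
    then have "?d \<in> ?W"
      using R.pairing_insert[OF N m d f] f fm by (simp add: R.lifts_def)
    then have "R.ext_mult ?N ?d x \<in> ?A" using x(1) by (rule R.koszul_alg.mult)
    then have "R.ext_mult ?N ?d x ?N \<in> R.kitt_top ?N f \<aa>" unfolding R.kitt_top_def by blast
    moreover have "R.ext_mult N ?d x ?N = \<zero>"
    proof -
      have "(\<lambda>i. R.cre i x ?N) \<in> R.fns" using xf by simp
      then have "R.pairing N ?d (\<lambda>i. R.cre i x ?N) = R.pairing N (\<lambda>i. R.cre i x ?N) ?d"
        using d by (intro R.pairing_comm)
      also have "\<dots> = \<zero>" using m xf by (intro R.pairing_zero) auto
      finally show ?thesis by (simp add: R.ext_mult_def R.lincomb_eq_pairing)
    qed
    then have "R.ext_mult ?N ?d x ?N = ext_sgn R (below m ?N) \<otimes> x N"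
      using R.ext_mult_insert[OF N m d xf] m xf by (simp add: R.cre_def)
    ultimately have "ext_sgn R (below m ?N) \<otimes> (ext_sgn R (below m ?N) \<otimes> x N) \<in> R.kitt_top ?N f \<aa>"
      using T.I_l_closed by simp
    then have "x N \<in> R.kitt_top ?N f \<aa>" using xf by simp
    then show "b \<in> h ` R.kitt_top ?N f \<aa>" using x(2) by blast
  qed
qed

end

theorem theorem4p26:
  fixes R :: "('a, 'b) ring_scheme" and \<aa> I :: "'a set" and f\<^sub>0 :: 'a
  assumes "cring R"
    and "fin_gen_ideal R \<aa>" and "fin_gen_ideal R I" and "\<aa> \<subseteq> I"
    and "f\<^sub>0 \<in> \<aa>" and "regular_elem R f\<^sub>0"
  shows "(\<lambda>x. genideal R {f\<^sub>0} +>\<^bsub>R\<^esub> x) ` Kitt R \<aa> I =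
         Kitt (R Quot genideal R {f\<^sub>0})
              ((\<lambda>x. genideal R {f\<^sub>0} +>\<^bsub>R\<^esub> x) ` \<aa>)
              ((\<lambda>x. genideal R {f\<^sub>0} +>\<^bsub>R\<^esub> x) ` I)"
proof -
  interpret cring R by fact
  have f0: "f\<^sub>0 \<in> carrier R" using assms(6) by (simp add: regular_elem_def)
  let ?J = "genideal R {f\<^sub>0}" let ?Q = "R Quot ?J" let ?h = "\<lambda>x. ?J +>\<^bsub>R\<^esub> x"
  interpret J: ideal ?J R using f0 by (intro genideal_ideal) simp
  interpret H: ring_hom_cring R ?Q "(+>\<^bsub>R\<^esub>) ?J" by (rule J.rcos_ring_hom_cring) fact
  have \<aa>: "ideal \<aa> R" and I: "ideal I R" using assms(2,3) by (simp_all add: fin_gen_ideal_def)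
  obtain T where T: "finite T" "T \<subseteq> carrier R" "I = genideal R T"
    using assms(3) by (auto simp: fin_gen_ideal_def)
  obtain fs where fs: "set fs = T" using finite_list[OF T(1)] by blast
  let ?r = "length fs" let ?N = "{..<?r}"
  \<comment> \<open>The default value makes index r, the first one past the list, carry
    \<open>f\<^sub>0\<close>.\<close>
  let ?f = "\<lambda>i. if i < ?r then fs ! i else f\<^sub>0"
  have f: "?f \<in> fns" using fs T(2) f0 by auto
  have fN: "?f ` ?N = T" using fs by (auto simp: in_set_conv_nth)
  have fN': "?f ` insert ?r ?N = insert f\<^sub>0 T"
    unfolding image_insert fN by simp
  \<comment> \<open>As \<open>f\<^sub>0\<close> lies in I, adjoining it leaves the ideal unchanged
    and the enlarged family may be used to compute \<open>Kitt\<close>.\<close>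
  have "genideal R (insert f\<^sub>0 T) = I"
  proof
    show "genideal R (insert f\<^sub>0 T) \<subseteq> I"
      using assms(4,5) T genideal_self[OF T(2)] by (intro genideal_minimal I) auto
    show "I \<subseteq> genideal R (insert f\<^sub>0 T)"
      unfolding T(3) genideal_def by (intro Inter_anti_mono) auto
  qed
  then have K: "Kitt R \<aa> I = kitt_top (insert ?r ?N) ?f \<aa>"
    using assms(2,4) f fN' by (intro Kitt_eq_kitt_top) auto
  have surj: "?h ` carrier R = carrier ?Q"
    unfolding FactRing_def A_RCOSETS_def' partial_object.simps by (simp only: UNION_singleton_eq_range)
  have zero: "?h a = \<zero>\<^bsub>?Q\<^esub> \<longleftrightarrow> (\<exists>b\<in>carrier R. a = f\<^sub>0 \<otimes>\<^bsub>R\<^esub> b)" if a: "a \<in> carrier R" for a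
  proof -
    have "?h a = \<zero>\<^bsub>?Q\<^esub> \<longleftrightarrow> a \<in> ?J"
    proof -
      have "\<zero>\<^bsub>?Q\<^esub> = ?J" by (simp only: FactRing_def ring.simps)
      moreover have "?h a = ?J" if "a \<in> ?J" by (rule J.a_rcos_const[OF that])
      moreover have "a \<in> ?J" if "?h a = ?J" using J.a_rcos_self[OF a] that by metis
      ultimately show ?thesis by metis
    qed
    moreover have "a \<in> ?J \<longleftrightarrow> (\<exists>b\<in>carrier R. a = f\<^sub>0 \<otimes>\<^bsub>R\<^esub> b)"
      unfolding cgenideal_eq_genideal[OF f0, symmetric] cgenideal_def using m_comm[OF f0] by auto
    ultimately show ?thesis by metis
  qed
  have "?h ` kitt_top (insert ?r ?N) ?f \<aa> = H.S.kitt_top ?N (\<lambda>i. ?h (?f i)) (?h ` \<aa>)"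
    using surj f \<aa> assms(5,6) zero by (intro H.image_kitt_top) (auto simp: regular_elem_def)
  also have "\<dots> = Kitt ?Q (?h ` \<aa>) (?h ` I)"
  proof (rule H.S.Kitt_eq_kitt_top[symmetric])
    show "fin_gen_ideal ?Q (?h ` \<aa>)" by (rule H.fin_gen_ideal_image[OF surj assms(2)])
    show "?h ` \<aa> \<subseteq> ?h ` I" using assms(4) by blast
    show "(\<lambda>i. ?h (?f i)) \<in> H.S.fns" using f by simp
    have "(\<lambda>i. ?h (?f i)) ` ?N = ?h ` T" using fN by auto
    then show "genideal ?Q ((\<lambda>i. ?h (?f i)) ` ?N) = ?h ` I"
      using H.image_genideal[OF surj T(2)] T(3) by simp
  qed simp
  finally show ?thesis using K by simp
qed

end
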